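(* Let $Z$ be a polygon ring composed of $n$ polygons with type $M_1M_2\cdots M_n$, where $M_i\in\{t(s_i,1),t(s_i,2),\dots,t(s_i,s_i-3)\}$. Then the number of maximal matchings of $Z$ is $$\Psi(Z)=\operatorname{tr}\Big(\prod_{i=1}^{n} f(M_i)\Big),$$ where $f(t(s_i,j))=T_{s_i,j}$ for $j\in\{1,\dots,s_i-3\}$.
   Context: A matching of a graph is maximal if it is not contained in any larger matching; $\Psi(X)$ is the number of maximal matchings of a graph $X$; $\operatorname{tr}$ is the trace. Polygon ring: a 2-connected plane graph whose faces (other than the outer and inner unbounded-type regions) are $n$ cycles $p_1,\dots,p_n$, $p_i$ of length $s_i\ge 4$, arranged cyclically: $p_{i-1}$ and $p_i$ share exactly one edge $e_i$ ($i=2,\dots,n$), $p_n$ and $p_1$ share exactly one edge $e_1$, no other pair shares an edge, and each vertex lies on at most two of these cycles. Fix a planar embedding. For each $i$ (indices mod $n$, $e_{n+1}=e_1$), $k_i\in[1,s_i-3]$ is the number of edges of $p_i$ strictly between $e_i$ and $e_{i+1}$ when $p_i$ is traversed clockwise starting from $e_i$; the type of the ring is $M_1\cdots M_n$ with $M_i=t(s_i,k_i)$. Definition of the $9\times 9$ matrix $T_{m,i}$ ($m\ge4$, $1\le i\le m-3$). Let $J$ be a cycle with vertices $v_0,v_1,\dots,v_{m-1}$ in cyclic order, and set $b=v_0$, $a=v_1$, $d=v_{i+1}$, $c=v_{i+2}$, $e=v_i$ (the neighbour of $d$ other than $c$; $e=a$ if $i=1$) and $f=v_{i+3}$ with $v_m=v_0$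 (the neighbour of $c$ other than $d$; $f=b$ if $i=m-3$). Let $J'$ be obtained from $J$ by deleting the edge $dc$ and adding two new vertices $k_1,k_2$ with edges $k_1d$ and $k_2c$. For $x=1,\dots,9$ define a set $\mathcal W_x$ of matchings and a vertex set $R_x$: $\mathcal W_1$= maximal matchings of $J'$, $R_1=\emptyset$; $\mathcal W_2$= maximal matchings of $J'-a$, $R_2=\{a\}$; $\mathcal W_3$= maximal matchings of $J'-b$, $R_3=\{b\}$; $\mathcal W_4$= maximal matchings of $J'-a-b$, $R_4=\{a,b\}$; $\mathcal W_5$= maximal matchings of $J'$ covering both $a$ and $b$, $R_5=\emptyset$; $\mathcal W_6$= maximal matchings of $J'-a$ covering $b$, $R_6=\{a\}$; $\mathcal W_7$= maximal matchings of $J'-b$ covering $a$, $R_7=\{b\}$; $\mathcal W_8$= maximal matchings of $J'$ covering $a$, $R_8=\emptyset$; $\mathcal W_9$= maximal matchings of $J'$ covering $b$, $R_9=\emptyset$. For $W\in\mathcal W_x$ let $V'$ be the set of vertices covered by $W$ together with $R_x$. Assign $W$ the first index $y\in\{1,\dots,9\}$ whose condition holds: $y=1$: $k_1,e,k_2,f\in V'$; $y=2$: $k_2,f\in V'$, $k_1\notin V'$; $y=3$: $k_1,e\in V'$, $k_2\notin V'$; $y=4$: $k_1,k_2\notin V'$; $y=5$: $e,f\notin V'$; $y=6$: $k_1,f\notin V'$; $y=7$: $k_2,e\notin V'$; $y=8$: $k_2,f\in V'$, $e\notin V'$; $y=9$: $k_1,e\in V'$, $f\notin V'$. Then $T_{m,i}[x,y]$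 is the number of $W\in\mathcal W_x$ assigned index $y$. *)

theory Defs
  imports "HOL-Complex_Analysis.Complex_Analysis"
begin

section \<open>Finite simple graphs and maximal matchings\<close>

definition simple_graph :: "'v set \<Rightarrow> 'v set set \<Rightarrow> bool" where
  "simple_graph V E \<longleftrightarrow> finite V \<and> (\<forall>e\<in>E. e \<subseteq> V \<and> card e = 2)"

definition graph_connected :: "'v set \<Rightarrow> 'v set set \<Rightarrow> bool" where
  "graph_connected V E \<longleftrightarrow> V \<noteq> {} \<and>
     (\<forall>u\<in>V. \<forall>v\<in>V. (u, v) \<in> {(x, y). x \<in> V \<and> y \<in> V \<and> {x, y} \<in> E}\<^sup>*)"

definition remove_vertices :: "'v set set \<Rightarrow> 'v set \<Rightarrow> 'v set set" where
  "remove_vertices E X = {e \<in> E. e \<inter> X = {}}"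

definition two_connected :: "'v set \<Rightarrow> 'v set set \<Rightarrow> bool" where
  "two_connected V E \<longleftrightarrow> 3 \<le> card V \<and> graph_connected V E \<and>
     (\<forall>x\<in>V. graph_connected (V - {x}) (remove_vertices E {x}))"

definition matching :: "'v set set \<Rightarrow> 'v set set \<Rightarrow> bool" where
  "matching E M \<longleftrightarrow> M \<subseteq> E \<and> (\<forall>e\<in>M. \<forall>e'\<in>M. e \<noteq> e' \<longrightarrow> e \<inter> e' = {})"

definition maximal_matchings :: "'v set set \<Rightarrow> 'v set set set" where
  "maximal_matchings E = {M. matching E M \<and> \<not> (\<exists>M'. matching E M' \<and> M \<subset> M')}"

definition Psi :: "'v set set \<Rightarrow> nat" where
  "Psi E = card (maximal_matchings E)"


section \<open>Cycles, given by the cyclic list of their vertices\<close>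

definition cycle_edge :: "'v list \<Rightarrow> nat \<Rightarrow> 'v set" where
  "cycle_edge ws j = {ws ! (j mod length ws), ws ! (Suc j mod length ws)}"

definition cycle_edges :: "'v list \<Rightarrow> 'v set set" where
  "cycle_edges ws = cycle_edge ws ` {..<length ws}"

definition is_cycle :: "'v set set \<Rightarrow> 'v list \<Rightarrow> bool" where
  "is_cycle E ws \<longleftrightarrow> 3 \<le> length ws \<and> distinct ws \<and> cycle_edges ws \<subseteq> E"


section \<open>Plane graphs\<close>

text \<open>A drawing in the complex plane: \<open>pos v\<close> is the point representing the vertex \<open>v\<close>, and
  \<open>\<gamma> u v\<close> parametrises the arc representing the edge \<open>{u, v}\<close>, run from \<open>u\<close> to \<open>v\<close>.\<close>

definition drawing :: "('v \<Rightarrow> 'v \<Rightarrow> real \<Rightarrow> complex) \<Rightarrow> 'v set set \<Rightarrow> complex set" where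
  "drawing \<gamma> E = \<Union> {path_image (\<gamma> u v) | u v. {u, v} \<in> E}"

definition faces ::
  "'v set \<Rightarrow> 'v set set \<Rightarrow> ('v \<Rightarrow> complex) \<Rightarrow> ('v \<Rightarrow> 'v \<Rightarrow> real \<Rightarrow> complex) \<Rightarrow> complex set set" where
  "faces V E pos \<gamma> = components (- (pos ` V \<union> drawing \<gamma> E))"

fun walk_path :: "('v \<Rightarrow> 'v \<Rightarrow> real \<Rightarrow> complex) \<Rightarrow> 'v list \<Rightarrow> real \<Rightarrow> complex" where
  "walk_path \<gamma> (u # v # w # ws) = \<gamma> u v +++ walk_path \<gamma> (v # w # ws)"
| "walk_path \<gamma> [u, v] = \<gamma> u v"
| "walk_path \<gamma> ws = undefined"

definition cycle_path :: "('v \<Rightarrow> 'v \<Rightarrow> real \<Rightarrow> complex) \<Rightarrow> 'v list \<Rightarrow> real \<Rightarrow> complex" where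
  "cycle_path \<gamma> ws = walk_path \<gamma> (ws @ [hd ws])"

text \<open>The list \<open>ws\<close> runs clockwise along the boundary of the bounded face \<open>F\<close>.\<close>

definition clockwise_boundary ::
  "('v \<Rightarrow> 'v \<Rightarrow> real \<Rightarrow> complex) \<Rightarrow> 'v list \<Rightarrow> complex set \<Rightarrow> bool" where
  "clockwise_boundary \<gamma> ws F \<longleftrightarrow> frontier F = drawing \<gamma> (cycle_edges ws) \<and>
     (\<forall>z\<in>F. winding_number (cycle_path \<gamma> ws) z = - 1)"

locale plane_graph =
  fixes V :: "'v set" and E :: "'v set set"
    and pos :: "'v \<Rightarrow> complex" and \<gamma> :: "'v \<Rightarrow> 'v \<Rightarrow> real \<Rightarrow> complex"
  assumes graph: "simple_graph V E"
    and pos_inj: "inj_on pos V"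
    and edge_arc: "{u, v} \<in> E \<Longrightarrow> arc (\<gamma> u v) \<and> pathstart (\<gamma> u v) = pos u \<and> pathfinish (\<gamma> u v) = pos v"
    and edge_reverse: "{u, v} \<in> E \<Longrightarrow> \<gamma> v u = reversepath (\<gamma> u v)"
    and edge_vertices: "{u, v} \<in> E \<Longrightarrow> path_image (\<gamma> u v) \<inter> pos ` V = {pos u, pos v}"
    and edges_cross: "{u, v} \<in> E \<Longrightarrow> {x, y} \<in> E \<Longrightarrow> {u, v} \<noteq> {x, y} \<Longrightarrow>
      path_image (\<gamma> u v) \<inter> path_image (\<gamma> x y) \<subseteq> pos ` V"


section \<open>Polygon rings\<close>

text \<open>The polygons \<open>p 1, \<dots>, p n\<close> are listed in clockwise order, starting at an arbitrary vertex;
  the cyclic successor of the index \<open>i \<in> {1..n}\<close> is \<open>i mod n + 1\<close>. For \<open>n = 1, 2\<close> the conditions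
  on the shared edges together with the existence of a type are contradictory, whence \<open>3 \<le> n\<close>. The face \<open>Out\<close> is the outer region and \<open>Inn\<close> the region enclosed by
  the ring.\<close>

locale polygon_ring = plane_graph V E pos \<gamma>
  for V :: "'v set" and E :: "'v set set"
    and pos :: "'v \<Rightarrow> complex" and \<gamma> :: "'v \<Rightarrow> 'v \<Rightarrow> real \<Rightarrow> complex" +
  fixes n :: nat and p :: "nat \<Rightarrow> 'v list" and e :: "nat \<Rightarrow> 'v set"
  assumes ring_two_connected: "two_connected V E"
    and ring_size: "3 \<le> n"
    and polygon: "i \<in> {1..n} \<Longrightarrow> is_cycle E (p i) \<and> 4 \<le> length (p i)"
    and ring_faces: "\<exists>F Out Inn. faces V E pos \<gamma> = F ` {1..n} \<union> {Out, Inn} \<and>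
        inj_on F {1..n} \<and> Out \<notin> F ` {1..n} \<and> Inn \<notin> F ` {1..n} \<and> Out \<noteq> Inn \<and>
        \<not> bounded Out \<and> (\<forall>i\<in>{1..n}. clockwise_boundary \<gamma> (p i) (F i))"
    and shared_edge: "i \<in> {1..n} \<Longrightarrow>
        cycle_edges (p i) \<inter> cycle_edges (p (i mod n + 1)) = {e (i mod n + 1)}"
    and no_other_shared_edge: "i \<in> {1..n} \<Longrightarrow> j \<in> {1..n} \<Longrightarrow> i \<noteq> j \<Longrightarrow>
        j \<noteq> i mod n + 1 \<Longrightarrow> i \<noteq> j mod n + 1 \<Longrightarrow> cycle_edges (p i) \<inter> cycle_edges (p j) = {}"
    and vertex_in_two_polygons: "v \<in> V \<Longrightarrow> card {i \<in> {1..n}. v \<in> set (p i)} \<le> 2"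

text \<open>\<open>Ty s k\<close> stands for the symbol \<open>t(s, k)\<close>.\<close>

datatype polygon_type = Ty nat nat

definition edges_strictly_between :: "'v list \<Rightarrow> 'v set \<Rightarrow> 'v set \<Rightarrow> nat \<Rightarrow> bool" where
  "edges_strictly_between ws e e' k \<longleftrightarrow> Suc k < length ws \<and>
     (\<exists>j<length ws. cycle_edge ws j = e \<and> cycle_edge ws (j + Suc k) = e')"

definition ring_type ::
  "nat \<Rightarrow> (nat \<Rightarrow> 'v list) \<Rightarrow> (nat \<Rightarrow> 'v set) \<Rightarrow> (nat \<Rightarrow> polygon_type) \<Rightarrow> bool" where
  "ring_type n p e M \<longleftrightarrow> (\<forall>i\<in>{1..n}. \<exists>k\<in>{1..length (p i) - 3}.
     M i = Ty (length (p i)) k \<and> edges_strictly_between (p i) (e i) (e (i mod n + 1)) k)"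


section \<open>The transfer matrices\<close>

datatype cut_vertex = Vx nat | K1 | K2

definition cut_cycle :: "nat \<Rightarrow> nat \<Rightarrow> cut_vertex set set" where
  "cut_cycle m i = ({{Vx j, Vx (Suc j mod m)} | j. j < m} - {{Vx (i + 1), Vx (i + 2)}})
     \<union> {{K1, Vx (i + 1)}, {K2, Vx (i + 2)}}"

text \<open>Rows and columns are indexed by the nine-element numeral type \<open>9\<close>, in which the numeral
  \<open>9\<close> denotes \<open>0\<close>, so that \<open>1, \<dots>, 9\<close> are its nine distinct elements.\<close>

definition removed :: "9 \<Rightarrow> cut_vertex set" where
  "removed x = (let b = Vx 0; a = Vx 1 in
     if x = 2 \<or> x = 6 then {a} else if x = 3 \<or> x = 7 then {b} else if x = 4 then {a, b} else {})"

definition must_cover :: "9 \<Rightarrow> cut_vertex set" where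
  "must_cover x = (let b = Vx 0; a = Vx 1 in
     if x = 5 then {a, b} else if x = 6 \<or> x = 9 then {b} else if x = 7 \<or> x = 8 then {a} else {})"

definition row_matchings :: "nat \<Rightarrow> nat \<Rightarrow> 9 \<Rightarrow> cut_vertex set set set" where
  "row_matchings m i x =
     {W \<in> maximal_matchings (remove_vertices (cut_cycle m i) (removed x)). must_cover x \<subseteq> \<Union>W}"

definition column_index :: "nat \<Rightarrow> nat \<Rightarrow> cut_vertex set \<Rightarrow> 9 option" where
  "column_index m i V' = (let e = Vx i; f = Vx ((i + 3) mod m) in
     if K1 \<in> V' \<and> e \<in> V' \<and> K2 \<in> V' \<and> f \<in> V' then Some 1
     else if K2 \<in> V' \<and> f \<in> V' \<and> K1 \<notin> V' then Some 2
     else if K1 \<in> V' \<and> e \<in> V' \<and> K2 \<notin> V' then Some 3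
     else if K1 \<notin> V' \<and> K2 \<notin> V' then Some 4
     else if e \<notin> V' \<and> f \<notin> V' then Some 5
     else if K1 \<notin> V' \<and> f \<notin> V' then Some 6
     else if K2 \<notin> V' \<and> e \<notin> V' then Some 7
     else if K2 \<in> V' \<and> f \<in> V' \<and> e \<notin> V' then Some 8
     else if K1 \<in> V' \<and> e \<in> V' \<and> f \<notin> V' then Some 9
     else None)"

definition transfer_matrix :: "nat \<Rightarrow> nat \<Rightarrow> nat^9^9" where
  "transfer_matrix m i =
     (\<chi> x y. card {W \<in> row_matchings m i x. column_index m i (\<Union>W \<union> removed x) = Some y})"

fun type_matrix :: "polygon_type \<Rightarrow> nat^9^9" where
  "type_matrix (Ty s j) = transfer_matrix s j"

text \<open>The operation \<open>*\<close> on \<open>nat^9^9\<close> is componentwise, hence no \<open>prod_list\<close> here.\<close>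

definition matrix_prod :: "('a::semiring_1^'n^'n) list \<Rightarrow> 'a^'n^'n" where
  "matrix_prod As = foldr (**) As (mat 1)"

end

theory Submission
  imports Defs
begin

text \<open>
  Drawing an edge between two points that the graph drawn so far already connects creates a new
  face, by the Jordan curve theorem; hence a connected plane graph with \<open>v\<close> vertices and \<open>l\<close> edges
  has at least \<open>l - v + 2\<close> faces. A polygon ring has only \<open>n + 2\<close> faces, and this leaves no room for
  an edge outside the polygons or for a vertex common to two polygons outside the edges \<open>e i\<close>.
  Two consecutive polygons, both run clockwise, traverse their common edge in opposite
  directions. So the ring is the abstract graph obtained by gluing \<open>n\<close> cycles along edges with
  reversed orientation.

  In the glued graph a matching is a family of sets of polygon edges, one for each polygon, where
  \<open>e (i + 1)\<close> is attributed to polygon \<open>i + 1\<close>. Whether the matching is maximal can be tested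
  polygon by polygon, once it is known for both ends of \<open>e i\<close> whether they are matched
  in the preceding polygon, or have there an uncovered neighbour and must therefore be covered, or
  neither. These are the nine states, and the families that pass all tests are the closed walks
  counted by the trace.
\<close>

section \<open>Counting faces\<close>

text \<open>The count behind the rigidity of the ring: let the union of the polygons have v vertices
  and l edges, and let w vertices lie on two polygons. The polygon lengths add up to l + n (by
  edges) and to v + w (by vertices), so l + 2 \<le> faces + v becomes w + 2 \<le> faces + n. The
  ends of the \<open>e i\<close> give w \<ge> 2 * n, and there are at most n + 2 faces, so both are
  equalities. An edge outside the union would close a loop, by 2-connectedness, and leave the union
  at most n + 1 faces.

  The number nine is 3 * 3, three statuses for each end of \<open>e i\<close>, encoded by
  \<open>removed\<close> and \<open>must_cover\<close>. The obstacle on the matching side is a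
  circular dependence: each state is computed from the one before it, all the way round, while the
  trace counts a matching exactly once only if its states exist and are unique. The circle breaks
  because the \<open>removed\<close> half of a state is read off the edges chosen in the preceding
  polygon alone, and the \<open>must_cover\<close> half needs only the \<open>removed\<close> half
  of the state before.\<close>

text \<open>Otherwise the inverse of the parametrisation would map a nonempty open set of the plane
  continuously and injectively into the real line, against invariance of dimension.\<close>

lemma interior_arc_image_empty:
  fixes g :: "real \<Rightarrow> complex"
  assumes "arc g"
  shows "interior (path_image g) = {}"
proof (rule ccontr)
  assume ne: "interior (path_image g) \<noteq> {}"
  obtain h where h: "homeomorphism {0..1} (path_image g) g h"
    using homeomorphism_arc[OF assms] by blast
  have "continuous_on (interior (path_image g)) h"
    using h interior_subset by (meson continuous_on_subset homeomorphism_def)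
  moreover have "inj_on h (interior (path_image g))"
    by (rule inj_on_inverseI[where g = g]) (use h interior_subset in \<open>fastforce simp: homeomorphism_def\<close>)
  ultimately have "DIM(complex) \<le> DIM(real)"
    using ne by (intro invariance_of_dimension[of "interior (path_image g)" h]) auto
  then show False by simp
qed

text \<open>Components of \<open>- K\<close> are open and \<open>L\<close> has empty interior, so
  each of them contains a point off \<open>L\<close> and encloses a component of \<open>- L\<close>.
  The map \<open>f\<close> to the enclosing component is thus onto, and it fails to be injective
  once two components of \<open>- L\<close> merge in \<open>- K\<close>.\<close>

lemma components_complement_mono:
  fixes K L :: "complex set"
  assumes "closed K" "K \<subseteq> L" "interior L = {}" "finite (components (- L))"
  shows "finite (components (- K))"
    and "card (components (- K)) \<le> card (components (- L))"
    and "x \<notin> L \<Longrightarrow> y \<notin> L \<Longrightarrow> connected_component (- K) x y \<Longrightarrow> \<not> connected_component (- L) x y \<Longrightarrow>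
      card (components (- K)) < card (components (- L))"
proof -
  define f where "f C = connected_component_set (- K) (SOME z. z \<in> C)" for C
  have f_eq: "f (connected_component_set (- L) z) = connected_component_set (- K) z" if "z \<notin> L" for z
  proof -
    let ?w = "SOME w. w \<in> connected_component_set (- L) z"
    have "z \<in> connected_component_set (- L) z"
      using that by (simp add: connected_component_refl)
    then have "?w \<in> connected_component_set (- L) z" by (rule someI)
    then have "connected_component (- K) z ?w"
      using assms(2) by (auto intro: connected_component_of_subset)
    then show ?thesis unfolding f_def
      by (metis connected_component_eq mem_Collect_eq)
  qed
  have sub: "components (- K) \<subseteq> f ` components (- L)"
  proof
    fix D assume D: "D \<in> components (- K)"
    have "open D" using D assms(1) open_components by blast
    moreover have "D \<noteq> {}" using D in_components_nonempty by blast
    ultimately have "\<not> D \<subseteq> L" using assms(3) interior_maximal by blast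
    then obtain z where z: "z \<in> D" "z \<notin> L" by blast
    have "D = connected_component_set (- K) z"
      by (metis D z(1) in_components_connected components_iff connected_component_eq)
    also have "\<dots> = f (connected_component_set (- L) z)" using f_eq[OF z(2)] by simp
    finally show "D \<in> f ` components (- L)"
      using z(2) by (auto simp: components_def)
  qed
  show fin: "finite (components (- K))" using sub assms(4) finite_subset by blast
  show le: "card (components (- K)) \<le> card (components (- L))"
    using sub assms(4) by (meson card_image_le card_mono finite_imageI le_trans)
  assume xy: "x \<notin> L" "y \<notin> L" "connected_component (- K) x y" "\<not> connected_component (- L) x y"
  have "card (f ` components (- L)) \<noteq> card (components (- L))"
  proof
    assume "card (f ` components (- L)) = card (components (- L))"
    then have "inj_on f (components (- L))" by (simp add: assms(4) eq_card_imp_inj_on)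
    moreover have "f (connected_component_set (- L) x) = f (connected_component_set (- L) y)"
      using xy f_eq by (metis connected_component_eq mem_Collect_eq)
    ultimately have "connected_component_set (- L) x = connected_component_set (- L) y"
      using xy(1,2) by (simp add: components_def inj_on_def)
    moreover have "y \<in> connected_component_set (- L) y" using xy(2) by (simp add: connected_component_refl)
    ultimately have "y \<in> connected_component_set (- L) x" by (simp only:)
    then show False using xy(4) by simp
  qed
  then have "card (f ` components (- L)) < card (components (- L))"
    using card_image_le[OF assms(4), of f] by simp
  then show "card (components (- K)) < card (components (- L))"
    using card_mono[OF finite_imageI[OF assms(4)] sub] by linarith
qed

text \<open>Closing a loop adds a face: the new arc together with an arc inside \<open>K\<close> is a Jordan curve,
  and the midpoint of the new arc is adherent to both of its sides.\<close>

lemma components_complement_add_arc: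
  fixes K :: "complex set"
  assumes K: "closed K" "interior K = {}" and g: "arc g"
    and meet: "path_image g \<inter> K = {pathstart g, pathfinish g}"
    and pc: "path_component K (pathstart g) (pathfinish g)"
    and fin: "finite (components (- (K \<union> path_image g)))"
  shows "card (components (- K)) < card (components (- (K \<union> path_image g)))"
proof -
  let ?L = "K \<union> path_image g"
  have ne: "pathstart g \<noteq> pathfinish g" using arc_distinct_ends[OF g] by metis
  obtain q where "path q" "path_image q \<subseteq> K" "pathstart q = pathfinish g" "pathfinish q = pathstart g"
    using pc path_component_sym[OF pc] unfolding path_component_def by blast
  \<comment> \<open>The path inside \<open>K\<close> is thinned to an arc so that the closed curve
    \<open>c\<close> becomes simple.\<close>
  then obtain h where h: "arc h" "path_image h \<subseteq> K" "pathstart h = pathfinish g" "pathfinish h = pathstart g"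
    using path_contains_arc[of q "pathfinish g" "pathstart g"] ne by (metis order_trans)
  define c where "c = g +++ h"
  have c: "simple_path c" unfolding c_def
    by (rule simple_path_join_loop) (use g h meet in auto)
  have loop: "pathfinish c = pathstart c" using h by (simp add: c_def)
  have imc: "path_image c = path_image g \<union> path_image h"
    unfolding c_def using h by (simp add: path_image_join)
  note J = Jordan_inside_outside[OF c loop]
  define z where "z = g (1/2)"
  have zg: "z \<in> path_image g" by (simp add: z_def path_image_def)
  have "inj_on g {0..1}" using g by (simp add: arc_def)
  then have "z \<noteq> pathstart g" "z \<noteq> pathfinish g"
    unfolding z_def pathstart_def pathfinish_def
    by (auto dest!: inj_onD[where x = "1/2"])
  then have zK: "z \<notin> K" using zg meet by blast
  obtain r where r: "r > 0" "ball z r \<subseteq> - K"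
    using K(1) zK open_contains_ball[of "- K"] by (auto simp: open_Compl)
  have "z \<in> closure (inside (path_image c))" "z \<in> closure (outside (path_image c))"
    using J zg imc unfolding frontier_def by blast+
  then obtain x y where x: "x \<in> inside (path_image c)" "dist x z < r"
    and y: "y \<in> outside (path_image c)" "dist y z < r"
    using r(1) by (meson closure_approachable)
  have xL: "x \<notin> ?L"
  proof -
    have "x \<notin> path_image c" using x(1) inside_no_overlap by blast
    then show ?thesis using x(2) r(2) imc by (auto simp: dist_commute subset_iff)
  qed
  have yL: "y \<notin> ?L"
  proof -
    have "y \<notin> path_image c" using y(1) outside_no_overlap by blast
    then show ?thesis using y(2) r(2) imc by (auto simp: dist_commute subset_iff)
  qed
  have same: "connected_component (- K) x y"
    unfolding connected_component_def using x y r
    by (intro exI[of _ "ball z r"]) (auto simp: dist_commute)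
  have diff: "\<not> connected_component (- ?L) x y"
  proof
    assume "connected_component (- ?L) x y"
    then obtain T where T: "connected T" "T \<subseteq> - ?L" "x \<in> T" "y \<in> T"
      unfolding connected_component_def by blast
    have "T \<subseteq> - path_image c" using T(2) imc h(2) by blast
    then have "T \<subseteq> inside (path_image c) \<union> outside (path_image c)" using J by simp
    moreover have "open (inside (path_image c))" "open (outside (path_image c))"
      "inside (path_image c) \<inter> outside (path_image c) \<inter> T = {}" using J by auto
    ultimately have "inside (path_image c) \<inter> T = {} \<or> outside (path_image c) \<inter> T = {}"
      using connectedD[OF T(1)] by metis
    then show False using T(3,4) x(1) y(1) by blast
  qed
  have "interior ?L = {}"
    using interior_closed_Un_empty_interior[OF K(1) interior_arc_image_empty[OF g]] K(2) by simp
  then show ?thesis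
    using components_complement_mono(3)[OF K(1) _ _ fin xL yL same diff] by blast
qed

text \<open>Connectedness in cut form: it directly supplies the edge by which a partial tree grows,
  and for the ring it is checked by letting an edge-closed vertex set spread from polygon to
  polygon.\<close>

definition crossing_connected :: "'v set \<Rightarrow> 'v set set \<Rightarrow> bool" where
  "crossing_connected S X \<longleftrightarrow>
     (\<forall>A. A \<subseteq> S \<longrightarrow> A \<noteq> {} \<longrightarrow> A \<noteq> S \<longrightarrow> (\<exists>u v. u \<in> A \<and> v \<in> S - A \<and> {u, v} \<in> X))"

section \<open>Euler's inequality for connected plane graphs\<close>

context plane_graph
begin

text \<open>The vertices are added separately so that a one-vertex tree, which has no edges, is
  drawn as a point.\<close>

definition skeleton :: "'v set \<Rightarrow> 'v set set \<Rightarrow> complex set" where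
  "skeleton S X = pos ` S \<union> drawing \<gamma> X"

lemma edge_cases:
  assumes "g \<in> E"
  obtains u v where "g = {u, v}" "u \<noteq> v" "u \<in> V" "v \<in> V"
proof -
  have "card g = 2" "g \<subseteq> V" using graph assms by (auto simp: simple_graph_def)
  then show thesis using that by (auto simp: card_2_iff)
qed

lemma finite_V: "finite V" and finite_E: "finite E"
proof -
  show *: "finite V" using graph by (simp add: simple_graph_def)
  have "E \<subseteq> Pow V" using graph by (auto simp: simple_graph_def)
  then show "finite E" using * by (meson finite_Pow_iff finite_subset)
qed

lemma edge_image_commute: "{u, v} \<in> E \<Longrightarrow> path_image (\<gamma> v u) = path_image (\<gamma> u v)"
  using edge_reverse by (simp add: path_image_reversepath)

lemma drawing_insert:
  assumes "{u, v} \<in> E"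
  shows "drawing \<gamma> (insert {u, v} X) = path_image (\<gamma> u v) \<union> drawing \<gamma> X"
  unfolding drawing_def using edge_image_commute[OF assms]
  by (fastforce simp: doubleton_eq_iff)

lemma drawing_empty: "drawing \<gamma> {} = {}" by (simp add: drawing_def)

lemma drawing_mono: "X \<subseteq> Y \<Longrightarrow> drawing \<gamma> X \<subseteq> drawing \<gamma> Y"
  by (auto simp: drawing_def)

lemma skeleton_insert:
  "{u, v} \<in> E \<Longrightarrow> skeleton S (insert {u, v} X) = skeleton S X \<union> path_image (\<gamma> u v)"
  by (auto simp: skeleton_def drawing_insert)

lemma skeleton_mono: "S \<subseteq> S' \<Longrightarrow> X \<subseteq> X' \<Longrightarrow> skeleton S X \<subseteq> skeleton S' X'"
  using drawing_mono[of X X'] by (auto simp: skeleton_def)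

lemma drawing_closed_interior_empty:
  assumes "X \<subseteq> E"
  shows "closed (drawing \<gamma> X) \<and> interior (drawing \<gamma> X) = {}"
proof -
  have "finite X" using assms finite_E finite_subset by blast
  then show ?thesis using assms
  proof (induction X)
    case empty
    then show ?case by (simp add: drawing_empty)
  next
    case (insert g X)
    then obtain u v where g: "g = {u, v}" by (meson edge_cases insert_subset)
    have uv: "{u, v} \<in> E" using insert.prems g by auto
    have "arc (\<gamma> u v)" using edge_arc[OF uv] by blast
    then show ?case
      using insert interior_closed_Un_empty_interior[of "path_image (\<gamma> u v)" "drawing \<gamma> X"]
      by (simp add: g drawing_insert[OF uv] closed_arc_image interior_arc_image_empty closed_Un)
  qed
qed

lemma skeleton_closed_interior_empty:
  assumes "S \<subseteq> V" "X \<subseteq> E"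
  shows "closed (skeleton S X)" and "interior (skeleton S X) = {}"
proof -
  have "finite (pos ` S)" using assms(1) finite_V finite_subset by blast
  then show "closed (skeleton S X)" "interior (skeleton S X) = {}"
    using drawing_closed_interior_empty[OF assms(2)]
      interior_closed_Un_empty_interior[of "pos ` S" "drawing \<gamma> X"]
    by (auto simp: skeleton_def closed_Un finite_imp_closed empty_interior_finite)
qed

lemma skeleton_components_mono:
  assumes "S \<subseteq> S'" "S' \<subseteq> V" "X \<subseteq> X'" "X' \<subseteq> E" "finite (components (- skeleton S' X'))"
  shows "finite (components (- skeleton S X))"
    and "card (components (- skeleton S X)) \<le> card (components (- skeleton S' X'))"
proof -
  have "closed (skeleton S X)" using assms by (intro skeleton_closed_interior_empty) auto
  moreover have "interior (skeleton S' X') = {}" using assms by (intro skeleton_closed_interior_empty)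
  ultimately show "finite (components (- skeleton S X))"
    "card (components (- skeleton S X)) \<le> card (components (- skeleton S' X'))"
    using components_complement_mono[OF _ skeleton_mono[OF assms(1,3)]] assms(5) by blast+
qed

lemma edge_meets_skeleton:
  assumes "S \<subseteq> V" "X \<subseteq> E" "{u, v} \<in> E" "{u, v} \<notin> X"
  shows "path_image (\<gamma> u v) \<inter> skeleton S X \<subseteq> {pos u, pos v}"
proof -
  have "path_image (\<gamma> u v) \<inter> path_image (\<gamma> x y) \<subseteq> pos ` V" if "{x, y} \<in> X" for x y
    using edges_cross[OF assms(3), of x y] that assms(2,4) by (metis subsetD)
  then have "path_image (\<gamma> u v) \<inter> skeleton S X \<subseteq> pos ` V"
    using assms(1) unfolding skeleton_def drawing_def by blast
  then show ?thesis using edge_vertices[OF assms(3)] by blast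
qed

lemma card_components_add_edge:
  assumes S: "S \<subseteq> V" "X \<subseteq> E" and uv: "{u, v} \<in> E" "{u, v} \<notin> X"
    and pc: "path_component (skeleton S X) (pos u) (pos v)"
    and fin: "finite (components (- skeleton S (insert {u, v} X)))"
  shows "card (components (- skeleton S X)) < card (components (- skeleton S (insert {u, v} X)))"
proof -
  have arc: "arc (\<gamma> u v)" "pathstart (\<gamma> u v) = pos u" "pathfinish (\<gamma> u v) = pos v"
    using edge_arc[OF uv(1)] by auto
  have "pos u \<in> skeleton S X" "pos v \<in> skeleton S X"
    using pc path_component_mem by blast+
  then have "path_image (\<gamma> u v) \<inter> skeleton S X = {pos u, pos v}"
    using edge_meets_skeleton[OF S uv] arc(2,3) pathstart_in_path_image[of "\<gamma> u v"]
      pathfinish_in_path_image[of "\<gamma> u v"] by auto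
  then show ?thesis
    unfolding skeleton_insert[OF uv(1)]
    using components_complement_add_arc[OF skeleton_closed_interior_empty[OF S] arc(1)] pc fin arc(2,3)
    by (simp add: skeleton_insert[OF uv(1)])
qed

text \<open>The tree grows by one vertex at a time along an edge leaving the current vertex set;
  \<open>k = card S\<close> gives a spanning tree. Path connectedness of its drawing is what later
  makes every further edge close a loop.\<close>

lemma spanning_tree_upto:
  assumes S: "S \<subseteq> V" "X \<subseteq> E" "crossing_connected S X" and k: "1 \<le> k" "k \<le> card S"
  shows "\<exists>A T. A \<subseteq> S \<and> T \<subseteq> X \<and> card A = k \<and> Suc (card T) = k \<and> \<Union>T \<subseteq> A \<and> path_connected (skeleton A T)"
  using k
proof (induction k rule: nat_induct_at_least)
  case base
  then obtain v where "v \<in> S" by fastforce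
  then show ?case
    by (intro exI[of _ "{v}"] exI[of _ "{}"]) (auto simp: skeleton_def drawing_empty)
next
  case (Suc k)
  then obtain A T where A: "A \<subseteq> S" "T \<subseteq> X" "card A = k" "Suc (card T) = k"
    "\<Union>T \<subseteq> A" "path_connected (skeleton A T)" by auto
  have "A \<noteq> {}" "A \<noteq> S" using A Suc by auto
  then obtain u v where uv: "u \<in> A" "v \<in> S - A" "{u, v} \<in> X"
    using S(3) A(1) unfolding crossing_connected_def by blast
  have finA: "finite A" "finite T"
    using A(1,2) S finite_V finite_E by (meson finite_subset order_trans)+
  have uvE: "{u, v} \<in> E" using uv S by auto
  have arc: "arc (\<gamma> u v)" "pathstart (\<gamma> u v) = pos u" "pathfinish (\<gamma> u v) = pos v"
    using edge_arc[OF uvE] by auto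
  have u: "pos u \<in> path_image (\<gamma> u v)" and v: "pos v \<in> path_image (\<gamma> u v)"
    using arc pathstart_in_path_image[of "\<gamma> u v"] pathfinish_in_path_image[of "\<gamma> u v"] by auto
  have eq: "skeleton (insert v A) (insert {u, v} T) = skeleton A T \<union> path_image (\<gamma> u v)"
    using v by (auto simp: skeleton_def drawing_insert[OF uvE])
  have "path_connected (skeleton A T \<union> path_image (\<gamma> u v))"
  proof (rule path_connected_Un[OF A(6)])
    show "path_connected (path_image (\<gamma> u v))"
      using arc(1) by (simp add: path_connected_path_image arc_imp_path)
    show "skeleton A T \<inter> path_image (\<gamma> u v) \<noteq> {}"
      using u uv(1) by (auto simp: skeleton_def)
  qed
  have pc: "path_connected (skeleton (insert v A) (insert {u, v} T))" unfolding eq by fact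
  \<comment> \<open>\<open>A\<close> contains all ends of \<open>T\<close> but not \<open>v\<close>,
    so the number of edges really rises by one.\<close>
  have "{u, v} \<notin> T" using A(5) uv(2) by auto
  then show ?case using A uv pc finA
    by (intro exI[of _ "insert v A"] exI[of _ "insert {u, v} T"]) auto
qed

lemma card_components_add_edges:
  assumes S: "S \<subseteq> V" and X: "finite Y" "Y \<subseteq> E" "T \<subseteq> E" "Y \<inter> T = {}" "\<Union>Y \<subseteq> S"
    and pc: "path_connected (skeleton S T)"
    and fin: "finite (components (- skeleton S (T \<union> Y)))"
  shows "card (components (- skeleton S T)) + card Y \<le> card (components (- skeleton S (T \<union> Y)))"
  using X fin
proof (induction Y)
  case (insert g Y)
  then obtain u v where g: "g = {u, v}" by (meson edge_cases insert_subset)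
  have uv: "{u, v} \<in> E" "{u, v} \<notin> T \<union> Y" "u \<in> S" "v \<in> S" "T \<union> Y \<subseteq> E"
    using insert g by auto
  have fin: "finite (components (- skeleton S (insert {u, v} (T \<union> Y))))"
    using insert.prems(5) g by simp
  have fin': "finite (components (- skeleton S (T \<union> Y)))"
    by (rule skeleton_components_mono(1)[OF _ _ _ _ fin]) (use S uv in auto)
  have "path_component (skeleton S T) (pos u) (pos v)"
    using pc uv(3,4) by (simp add: path_connected_component skeleton_def)
  then have "path_component (skeleton S (T \<union> Y)) (pos u) (pos v)"
    using skeleton_mono[of S S T "T \<union> Y"] by (auto elim: path_component_of_subset[rotated])
  then have "card (components (- skeleton S (T \<union> Y))) < card (components (- skeleton S (insert {u, v} (T \<union> Y))))"
    using card_components_add_edge[OF S uv(5) uv(1,2) _ fin] by blast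
  moreover have "card (components (- skeleton S T)) + card Y \<le> card (components (- skeleton S (T \<union> Y)))"
    using insert fin' by auto
  ultimately show ?case using insert g by simp
qed simp

text \<open>A spanning tree has \<open>card S - 1\<close> edges and leaves at least one component;
  each of the remaining edges adds at least one more.\<close>

lemma euler_lower_bound:
  assumes S: "S \<subseteq> V" "S \<noteq> {}" "X \<subseteq> E" "\<Union>X \<subseteq> S" "crossing_connected S X"
    and fin: "finite (components (- skeleton S X))"
  shows "card X + 2 \<le> card (components (- skeleton S X)) + card S"
proof -
  have finS: "finite S" "finite X" using S finite_V finite_E finite_subset by blast+
  then have "1 \<le> card S" using S(2) by (simp add: Suc_le_eq card_gt_0_iff)
  then obtain A T where A: "A \<subseteq> S" "T \<subseteq> X" "card A = card S" "Suc (card T) = card S"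
    "path_connected (skeleton A T)"
    using spanning_tree_upto[OF S(1,3,5), of "card S"] by auto
  have "A = S" using A(1,3) finS(1) by (simp add: card_subset_eq)
  have TE: "T \<subseteq> E" using A S by auto
  have XT: "T \<union> (X - T) = X" using A by auto
  have "card (components (- skeleton S T)) + card (X - T) \<le> card (components (- skeleton S (T \<union> (X - T))))"
    by (rule card_components_add_edges) (use S A finS \<open>A = S\<close> fin XT in auto)
  \<comment> \<open>A set with empty interior is not the whole plane, so the tree leaves some
    component.\<close>
  moreover have "card (components (- skeleton S T)) \<noteq> 0"
  proof -
    have "finite (components (- skeleton S T))"
      by (rule skeleton_components_mono(1)[OF _ _ _ _ fin]) (use S A in auto)
    moreover have "skeleton S T \<noteq> UNIV"
      using skeleton_closed_interior_empty(2)[OF S(1) TE] by auto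
    ultimately show ?thesis by (auto simp: components_eq_empty)
  qed
  moreover have "card (X - T) = card X - card T" "card T \<le> card X"
    using A finS by (auto simp: card_Diff_subset card_mono finite_subset)
  ultimately show ?thesis using XT A(4) by simp
qed

lemma path_component_walk:
  assumes "(u, v) \<in> {(x, y). x \<in> S \<and> y \<in> S \<and> {x, y} \<in> X}\<^sup>*" "X \<subseteq> E" "u \<in> S"
  shows "path_component (skeleton S X) (pos u) (pos v)"
  using assms(1)
proof (induction rule: rtrancl_induct)
  case base
  then show ?case using assms(3) by (auto simp: skeleton_def path_component_refl)
next
  case (step y z)
  have yz: "{y, z} \<in> X" "{y, z} \<in> E" using step assms(2) by auto
  have "path_image (\<gamma> y z) \<subseteq> skeleton S X"
    using yz by (auto simp: skeleton_def drawing_def)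
  moreover have "arc (\<gamma> y z)" "pathstart (\<gamma> y z) = pos y" "pathfinish (\<gamma> y z) = pos z"
    using edge_arc[OF yz(2)] by auto
  ultimately have "path_component (skeleton S X) (pos y) (pos z)"
    unfolding path_component_def by (metis arc_imp_path)
  then show ?case using step.IH path_component_trans by blast
qed

text \<open>There is a third vertex \<open>w\<close>. Deleting \<open>v\<close> leaves a walk from
  \<open>u\<close> to \<open>w\<close>, deleting \<open>u\<close> leaves one from \<open>v\<close>
  to \<open>w\<close>, and neither uses the edge \<open>{u, v}\<close>.\<close>

lemma two_connected_no_bridge:
  assumes tc: "two_connected V E" and uv: "{u, v} \<in> E"
  shows "path_component (skeleton V (E - {{u, v}})) (pos u) (pos v)"
proof -
  have ne: "u \<noteq> v" "u \<in> V" "v \<in> V"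
  proof -
    have "card {u, v} = 2" "{u, v} \<subseteq> V" using uv graph by (auto simp: simple_graph_def)
    then show "u \<noteq> v" "u \<in> V" "v \<in> V" by (auto split: if_splits simp: card_insert_if)
  qed
  have "3 \<le> card V" using tc by (simp add: two_connected_def)
  then have "\<not> V \<subseteq> {u, v}" using ne(1) card_mono[of "{u, v}" V] by auto
  then obtain w where w: "w \<in> V" "w \<noteq> u" "w \<noteq> v" by blast
  have *: "path_component (skeleton V (E - {{u, v}})) (pos a) (pos w)"
    if "a \<in> V" "a \<noteq> x" "x \<in> {u, v}" for a x
  proof -
    have "x \<in> V" using that ne by auto
    then have "(a, w) \<in> {(y, z). y \<in> V - {x} \<and> z \<in> V - {x} \<and> {y, z} \<in> remove_vertices E {x}}\<^sup>*"
      using tc w that unfolding two_connected_def graph_connected_def by blast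
    then have "(a, w) \<in> {(y, z). y \<in> V \<and> z \<in> V \<and> {y, z} \<in> E - {{u, v}}}\<^sup>*"
      by (rule rtrancl_mono[THEN subsetD, rotated]) (use that in \<open>auto simp: remove_vertices_def\<close>)
    then show ?thesis using that by (intro path_component_walk) auto
  qed
  show ?thesis
    by (rule path_component_trans[OF *[of u v] path_component_sym[OF *[of v u]]]) (use ne in auto)
qed

text \<open>An edge missing from \<open>X\<close> is no bridge, so drawing it last closes a loop and
  adds a component strictly.\<close>

lemma card_components_two_connected:
  assumes tc: "two_connected V E" and S: "S \<subseteq> V" "X \<subseteq> E" "X \<noteq> E"
    and fin: "finite (components (- skeleton V E))"
  shows "card (components (- skeleton S X)) < card (components (- skeleton V E))"
proof -
  obtain g where g: "g \<in> E" "g \<notin> X" using S by auto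
  then obtain u v where uv: "g = {u, v}" by (meson edge_cases)
  have ins: "insert {u, v} (E - {{u, v}}) = E" using g uv by auto
  have lt: "card (components (- skeleton V (E - {{u, v}}))) < card (components (- skeleton V E))"
    using card_components_add_edge[of V "E - {{u, v}}" u v] two_connected_no_bridge[OF tc] g uv fin ins
    by auto
  have fin': "finite (components (- skeleton V (E - {{u, v}})))"
    by (rule skeleton_components_mono(1)[OF _ _ _ _ fin]) auto
  have "card (components (- skeleton S X)) \<le> card (components (- skeleton V (E - {{u, v}})))"
    by (rule skeleton_components_mono(2)[OF _ _ _ _ fin']) (use S g uv in auto)
  then show ?thesis using lt by simp
qed

end

section \<open>Orientation of common edges\<close>

fun walk_edges :: "'v list \<Rightarrow> 'v set set" where
  "walk_edges (u # v # ws) = insert {u, v} (walk_edges (v # ws))"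
| "walk_edges ws = {}"

text \<open>The weight may depend on the direction of a step: it will be
  \<open>winding_number (\<gamma> u v) z\<close>.\<close>

fun walk_sum :: "('v \<Rightarrow> 'v \<Rightarrow> 'b::comm_monoid_add) \<Rightarrow> 'v list \<Rightarrow> 'b" where
  "walk_sum f (u # v # ws) = f u v + walk_sum f (v # ws)"
| "walk_sum f ws = 0"

lemma walk_edges_snoc: "walk_edges (ws @ [u, v]) = insert {u, v} (walk_edges (ws @ [u]))"
  by (induction ws rule: walk_edges.induct) auto

lemma walk_sum_snoc: "walk_sum f (ws @ [u, v]) = walk_sum f (ws @ [u]) + f u v"
  by (induction ws rule: walk_edges.induct) (auto simp: add.assoc)

text \<open>Closed walks get rotated so that a chosen edge comes first. Neither the edge set nor, in
  the next lemma, the directed sum depends on the starting vertex.\<close>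

lemma walk_edges_rotate:
  "walk_edges (rotate j ws @ [hd (rotate j ws)]) = walk_edges (ws @ [hd ws])"
proof (induction j)
  case (Suc j)
  have "walk_edges (rotate1 xs @ [hd (rotate1 xs)]) = walk_edges (xs @ [hd xs])" for xs :: "'a list"
  proof (cases xs rule: walk_edges.cases)
    case (1 u v ws)
    then show ?thesis using walk_edges_snoc[of "v # ws" u v] by simp
  qed auto
  then show ?case using Suc by simp
qed simp

lemma walk_sum_rotate:
  fixes ws :: "'a list"
  shows "walk_sum f (rotate j ws @ [hd (rotate j ws)]) = walk_sum f (ws @ [hd ws])"
proof (induction j)
  case (Suc j)
  have "walk_sum f (rotate1 xs @ [hd (rotate1 xs)]) = walk_sum f (xs @ [hd xs])" for xs :: "'a list"
  proof (cases xs rule: walk_edges.cases)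
    case (1 u v ws)
    then show ?thesis using walk_sum_snoc[of f "v # ws" u v] by (simp add: add.commute)
  qed auto
  then show ?case using Suc by simp
qed simp

lemma walk_edges_conv_nth: "walk_edges ws = {{ws ! i, ws ! Suc i} | i. Suc i < length ws}"
proof (induction ws rule: walk_edges.induct)
  case (1 u v ws)
  have "{{(u # v # ws) ! i, (u # v # ws) ! Suc i} | i. Suc i < length (u # v # ws)}
    = insert {u, v} {{(v # ws) ! i, (v # ws) ! Suc i} | i. Suc i < length (v # ws)}" (is "?L = ?R")
  proof
    show "?L \<subseteq> ?R"
    proof
      fix g assume "g \<in> ?L"
      then obtain i where i: "g = {(u # v # ws) ! i, (u # v # ws) ! Suc i}" "Suc i < length (u # v # ws)"
        by blast
      then show "g \<in> ?R" by (cases i) auto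
    qed
    show "?R \<subseteq> ?L"
    proof
      fix g assume "g \<in> ?R"
      then consider "g = {u, v}" | i where "g = {(v # ws) ! i, (v # ws) ! Suc i}" "Suc i < length (v # ws)"
        by blast
      then show "g \<in> ?L"
      proof cases
        case 1
        then show ?thesis by (intro CollectI exI[of _ 0]) auto
      next
        case (2 i)
        then show ?thesis by (intro CollectI exI[of _ "Suc i"]) auto
      qed
    qed
  qed
  then show ?case using 1 by simp
qed auto

lemma cycle_edges_eq_walk_edges:
  assumes "ws \<noteq> []"
  shows "cycle_edges ws = walk_edges (ws @ [hd ws])"
proof -
  have "{ws ! (i mod length ws), ws ! (Suc i mod length ws)} = {(ws @ [hd ws]) ! i, (ws @ [hd ws]) ! Suc i}"
    if "i < length ws" for i
    using that assms by (cases "Suc i = length ws") (auto simp: nth_append hd_conv_nth)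
  then show ?thesis
    unfolding cycle_edges_def walk_edges_conv_nth cycle_edge_def by (force simp: image_def)
qed

lemma walk_edges_subset_set: "g \<in> walk_edges ws \<Longrightarrow> g \<subseteq> set ws"
  by (induction ws rule: walk_edges.induct) auto

section \<open>Winding numbers of face boundaries\<close>

context plane_graph
begin

lemma vertex_on_edge:
  assumes "{x, y} \<in> E" "w \<in> V" "pos w \<in> path_image (\<gamma> x y)"
  shows "w = x \<or> w = y"
proof -
  have "pos w \<in> {pos x, pos y}" using edge_vertices[OF assms(1)] assms(2,3) by blast
  moreover have "x \<in> V" "y \<in> V" using assms(1) graph by (auto simp: simple_graph_def)
  ultimately show ?thesis using pos_inj assms(2) by (auto dest: inj_onD)
qed

lemma walk_path_props:
  assumes "walk_edges ws \<subseteq> E" "2 \<le> length ws"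
  shows "path (walk_path \<gamma> ws) \<and> pathstart (walk_path \<gamma> ws) = pos (hd ws) \<and>
    pathfinish (walk_path \<gamma> ws) = pos (last ws) \<and>
    path_image (walk_path \<gamma> ws) = drawing \<gamma> (walk_edges ws)"
  using assms
proof (induction ws rule: induct_list012)
  case (3 u v ws)
  have uv: "{u, v} \<in> E" using 3 by simp
  have arc: "arc (\<gamma> u v)" "pathstart (\<gamma> u v) = pos u" "pathfinish (\<gamma> u v) = pos v"
    using edge_arc[OF uv] by auto
  show ?case
  proof (cases ws)
    case Nil
    then show ?thesis
      using arc drawing_insert[OF uv, of "{}"] by (simp add: arc_imp_path drawing_empty)
  next
    case (Cons w ws')
    have "path (walk_path \<gamma> (v # ws)) \<and> pathstart (walk_path \<gamma> (v # ws)) = pos v \<and>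
      pathfinish (walk_path \<gamma> (v # ws)) = pos (last (v # ws)) \<and>
      path_image (walk_path \<gamma> (v # ws)) = drawing \<gamma> (walk_edges (v # ws))"
      using 3 Cons by simp
    moreover have "walk_path \<gamma> (u # v # ws) = \<gamma> u v +++ walk_path \<gamma> (v # ws)"
      using Cons by simp
    ultimately show ?thesis
      using arc drawing_insert[OF uv] by (simp add: arc_imp_path path_image_join)
  qed
qed auto

lemma walk_path_winding:
  assumes "walk_edges ws \<subseteq> E" "2 \<le> length ws" "z \<notin> drawing \<gamma> (walk_edges ws)"
  shows "winding_number (walk_path \<gamma> ws) z = walk_sum (\<lambda>u v. winding_number (\<gamma> u v) z) ws"
  using assms
proof (induction ws rule: induct_list012)
  case (3 u v ws)
  have uv: "{u, v} \<in> E" using 3 by simp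
  have arc: "path (\<gamma> u v)" "pathfinish (\<gamma> u v) = pos v"
    using edge_arc[OF uv] by (auto simp: arc_imp_path)
  show ?case
  proof (cases ws)
    case (Cons w ws')
    have sub: "walk_edges (v # ws) \<subseteq> E" "2 \<le> length (v # ws)" using 3 Cons by auto
    have z: "z \<notin> path_image (\<gamma> u v)" "z \<notin> drawing \<gamma> (walk_edges (v # ws))"
      using 3(5) drawing_insert[OF uv, of "walk_edges (v # ws)"] by auto
    have "winding_number (\<gamma> u v +++ walk_path \<gamma> (v # ws)) z
      = winding_number (\<gamma> u v) z + winding_number (walk_path \<gamma> (v # ws)) z"
      using walk_path_props[OF sub] arc z by (intro winding_number_join) auto
    moreover have "walk_path \<gamma> (u # v # ws) = \<gamma> u v +++ walk_path \<gamma> (v # ws)"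
      using Cons by simp
    ultimately show ?thesis using 3(2)[OF sub z(2)] by simp
  qed simp
qed auto

lemma edge_meets_walk:
  assumes "walk_edges ws \<subseteq> E" "{u, v} \<in> E" "{u, v} \<notin> walk_edges ws"
  shows "path_image (\<gamma> u v) \<inter> drawing \<gamma> (walk_edges ws) \<subseteq> {pos u, pos v}"
  using edge_meets_skeleton[of "{}" "walk_edges ws" u v] assms by (auto simp: skeleton_def)

text \<open>The first vertex lies on no later edge, because an arc contains no vertices but its
  ends; so the first arc meets the rest of the walk in \<open>v\<close> only.\<close>

lemma walk_path_arc:
  assumes "walk_edges ws \<subseteq> E" "2 \<le> length ws" "distinct ws"
  shows "arc (walk_path \<gamma> ws)"
  using assms
proof (induction ws rule: induct_list012)
  case (3 u v ws)
  have uv: "{u, v} \<in> E" using 3 by simp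
  have arc: "arc (\<gamma> u v)" "pathfinish (\<gamma> u v) = pos v"
    using edge_arc[OF uv] by auto
  show ?case
  proof (cases ws)
    case Nil
    then show ?thesis using arc by simp
  next
    case (Cons w ws')
    have sub: "walk_edges (v # ws) \<subseteq> E" "2 \<le> length (v # ws)" "distinct (v # ws)" using 3 Cons by auto
    have u: "u \<notin> set (v # ws)" using 3 by auto
    have "pos u \<notin> drawing \<gamma> (walk_edges (v # ws))"
    proof
      assume "pos u \<in> drawing \<gamma> (walk_edges (v # ws))"
      then obtain x y where xy: "{x, y} \<in> walk_edges (v # ws)" "pos u \<in> path_image (\<gamma> x y)"
        by (auto simp: drawing_def)
      moreover have "u \<in> V" using uv graph by (auto simp: simple_graph_def)
      ultimately have "u = x \<or> u = y" using vertex_on_edge[of x y u] sub(1) by auto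
      then show False using walk_edges_subset_set[OF xy(1)] u by auto
    qed
    moreover have "{u, v} \<notin> walk_edges (v # ws)"
      using u walk_edges_subset_set[of "{u, v}" "v # ws"] by auto
    ultimately have "path_image (\<gamma> u v) \<inter> drawing \<gamma> (walk_edges (v # ws)) \<subseteq> {pos v}"
      using edge_meets_walk[OF sub(1) uv] by auto
    then have "arc (\<gamma> u v +++ walk_path \<gamma> (v # ws))"
      using 3(2)[OF sub] walk_path_props[OF sub(1,2)] arc by (intro arc_join) auto
    then show ?thesis using Cons by simp
  qed
qed auto

text \<open>After rotation the cycle is the edge from \<open>u\<close> to \<open>v\<close> followed
  by the arc \<open>A\<close> of all other edges. The base point of \<open>cycle_path\<close> may
  differ from \<open>u\<close>, but a sum of winding numbers over the edges is invariant under
  rotation.\<close>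

lemma cycle_split:
  assumes cyc: "is_cycle E ws" and j: "j < length ws"
    and u: "u = ws ! j" and v: "v = ws ! (Suc j mod length ws)"
  obtains A where "{u, v} \<in> E" "path A" "pathstart A = pos v" "pathfinish A = pos u"
    "path_image (\<gamma> u v) \<union> path_image A = drawing \<gamma> (cycle_edges ws)"
    "path_image (\<gamma> u v) \<inter> path_image A \<subseteq> {pos u, pos v}"
    "\<And>z. z \<notin> drawing \<gamma> (cycle_edges ws) \<Longrightarrow>
      winding_number (cycle_path \<gamma> ws) z = winding_number (\<gamma> u v) z + winding_number A z"
    "simple_path (\<gamma> u v +++ A)"
proof -
  have len: "3 \<le> length ws" and dist: "distinct ws" and sub: "cycle_edges ws \<subseteq> E"
    using cyc by (auto simp: is_cycle_def)
  define xs where "xs = rotate j ws"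
  have lxs: "length xs = length ws" "distinct xs" by (auto simp: xs_def dist)
  have x0: "xs ! 0 = u" using j u nth_rotate[of 0 ws j] by (cases ws) (auto simp: xs_def)
  have x1: "xs ! 1 = v" using len v by (simp add: xs_def nth_rotate)
  obtain w ys where xs: "xs = u # v # w # ys"
  proof -
    obtain a b c ys where "xs = a # b # c # ys"
      using len lxs(1) by (metis One_nat_def Suc_le_length_iff numeral_3_eq_3)
    then show thesis using x0 x1 that by auto
  qed
  have ne: "ws \<noteq> []" using len by auto
  have ce: "cycle_edges ws = insert {u, v} (walk_edges (v # w # ys @ [u]))"
    using cycle_edges_eq_walk_edges[OF ne] walk_edges_rotate[of j ws] xs by (simp add: xs_def)
  have sub': "walk_edges (v # w # ys @ [u]) \<subseteq> E" using sub ce by simp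
  have uv: "{u, v} \<in> E" using sub ce by simp
  define A where "A = walk_path \<gamma> (v # w # ys @ [u])"
  have A: "path A" "pathstart A = pos v" "pathfinish A = pos u"
    "path_image A = drawing \<gamma> (walk_edges (v # w # ys @ [u]))"
    unfolding A_def using walk_path_props[OF sub'] by auto
  have arcA: "arc A" unfolding A_def using walk_path_arc[OF sub'] lxs(2) xs by auto
  have dr: "drawing \<gamma> (cycle_edges ws) = path_image (\<gamma> u v) \<union> path_image A"
    unfolding ce A(4) using drawing_insert[OF uv] .
  \<comment> \<open>Length at least 3 matters here: since \<open>w\<close> differs from
    \<open>u\<close>, the way back does not reuse the same edge.\<close>
  have notin: "{u, v} \<notin> walk_edges (v # w # ys @ [u])"
  proof
    assume "{u, v} \<in> walk_edges (v # w # ys @ [u])"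
    moreover have "w \<noteq> u" "w \<noteq> v" using lxs(2) xs by auto
    ultimately have "{u, v} \<in> walk_edges (w # ys @ [u])" by (auto simp: doubleton_eq_iff)
    then have "v \<in> set (w # ys @ [u])" using walk_edges_subset_set by blast
    then show False using lxs(2) xs by auto
  qed
  have meet: "path_image (\<gamma> u v) \<inter> path_image A \<subseteq> {pos u, pos v}"
    unfolding A(4) by (rule edge_meets_walk[OF sub' uv notin])
  have arc: "arc (\<gamma> u v)" "pathstart (\<gamma> u v) = pos u" "pathfinish (\<gamma> u v) = pos v"
    using edge_arc[OF uv] by auto
  have "simple_path (\<gamma> u v +++ A)"
    by (rule simple_path_join_loop) (use arc arcA A meet in auto)
  moreover have "winding_number (cycle_path \<gamma> ws) z = winding_number (\<gamma> u v) z + winding_number A z"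
    if z: "z \<notin> drawing \<gamma> (cycle_edges ws)" for z
  proof -
    let ?f = "\<lambda>u v. winding_number (\<gamma> u v) z"
    have "winding_number (cycle_path \<gamma> ws) z = walk_sum ?f (ws @ [hd ws])"
      unfolding cycle_path_def using z len sub cycle_edges_eq_walk_edges[OF ne]
      by (intro walk_path_winding) auto
    also have "\<dots> = walk_sum ?f (xs @ [hd xs])" unfolding xs_def by (simp add: walk_sum_rotate)
    also have "\<dots> = ?f u v + walk_sum ?f (v # w # ys @ [u])" using xs by simp
    also have "walk_sum ?f (v # w # ys @ [u]) = winding_number A z"
      unfolding A_def using z dr A(4) sub' by (intro walk_path_winding[symmetric]) auto
    finally show ?thesis .
  qed
  ultimately show thesis using that[OF uv A(1-3) dr[symmetric] meet] by blast
qed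

lemma face_props:
  assumes "F \<in> faces V E pos \<gamma>"
  shows "connected F" "F \<noteq> {}" "X \<subseteq> E \<Longrightarrow> F \<inter> drawing \<gamma> X = {}"
  using assms drawing_mono[of X E] in_components_subset[of F] in_components_connected in_components_nonempty
  unfolding faces_def by fastforce+

text \<open>\<open>clockwise_boundary\<close> prescribes the winding number on \<open>F\<close>
  only. Being nonzero there, it places a point of \<open>F\<close> inside the boundary curve; the
  inside is connected and avoids the frontier of \<open>F\<close>, so it is contained in
  \<open>F\<close>, and every other face lies outside.\<close>

lemma clockwise_face_winding:
  assumes cyc: "is_cycle E ws" and F: "F \<in> faces V E pos \<gamma>" "clockwise_boundary \<gamma> ws F"
    and F': "F' \<in> faces V E pos \<gamma>" "F' \<noteq> F" and z: "z \<in> F'"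
  shows "winding_number (cycle_path \<gamma> ws) z = 0"
proof -
  have sub: "cycle_edges ws \<subseteq> E" and "0 < length ws" using cyc by (auto simp: is_cycle_def)
  then obtain u v A where A: "{u, v} \<in> E" "path A" "pathstart A = pos v" "pathfinish A = pos u"
    "path_image (\<gamma> u v) \<union> path_image A = drawing \<gamma> (cycle_edges ws)"
    "\<And>z. z \<notin> drawing \<gamma> (cycle_edges ws) \<Longrightarrow>
      winding_number (cycle_path \<gamma> ws) z = winding_number (\<gamma> u v) z + winding_number A z"
    "simple_path (\<gamma> u v +++ A)"
    using cycle_split[OF cyc] by metis
  define c where "c = \<gamma> u v +++ A"
  have arc: "arc (\<gamma> u v)" "pathstart (\<gamma> u v) = pos u" "pathfinish (\<gamma> u v) = pos v"
    using edge_arc[OF A(1)] by auto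
  have c: "simple_path c" "pathfinish c = pathstart c" using A arc by (auto simp: c_def)
  have imc: "path_image c = drawing \<gamma> (cycle_edges ws)"
    using A arc by (simp add: c_def path_image_join)
  have w: "winding_number (cycle_path \<gamma> ws) z = winding_number c z" if "z \<notin> path_image c" for z
    using that A arc imc unfolding c_def
    by (subst winding_number_join) (auto simp: arc_imp_path path_image_join)
  note J = Jordan_inside_outside[OF c]
  note off = face_props(3)[OF F(1) sub, folded imc] face_props(3)[OF F'(1) sub, folded imc]
  obtain z0 where z0: "z0 \<in> F" using face_props(2)[OF F(1)] by blast
  have "winding_number c z0 = - 1"
  proof -
    have "z0 \<notin> path_image c" using z0 off by blast
    then show ?thesis using F(2) z0 w[of z0] unfolding clockwise_boundary_def by simp
  qed
  then have "z0 \<notin> outside (path_image c)"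
    using winding_number_zero_in_outside[OF simple_path_imp_path[OF c(1)] c(2)] by force
  then have z0': "z0 \<in> inside (path_image c)" using J z0 off by blast
  have "inside (path_image c) \<subseteq> F"
  proof (rule ccontr)
    assume "\<not> inside (path_image c) \<subseteq> F"
    then have "inside (path_image c) \<inter> frontier F \<noteq> {}"
      using J z0 z0' by (intro connected_Int_frontier) auto
    moreover have "frontier F = path_image c"
      using F(2) imc by (simp add: clockwise_boundary_def)
    ultimately show False using inside_no_overlap by blast
  qed
  moreover have "F \<inter> F' = {}"
    using F(1) F' components_nonoverlap unfolding faces_def by blast
  ultimately have "z \<notin> inside (path_image c)" using z by blast
  moreover have "z \<in> inside (path_image c) \<union> outside (path_image c)" 
    using z off inside_Un_outside[of "path_image c"] by blast
  ultimately have "z \<in> outside (path_image c)" by blast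
  then have "winding_number c z = 0"
    by (rule winding_number_zero_in_outside[OF simple_path_imp_path[OF c(1)] c(2)])
  then show ?thesis using w[of z] z off by auto
qed

text \<open>If both polygons ran along the common edge in the same direction, the difference of the two
  boundary cycles would be a loop avoiding the midpoint of that edge, while its winding number
  takes the values \<open>-1\<close> and \<open>1\<close> arbitrarily close to this midpoint.\<close>

lemma clockwise_faces_opposite:
  assumes cyc: "is_cycle E ws" "is_cycle E ws'"
    and F: "F \<in> faces V E pos \<gamma>" "clockwise_boundary \<gamma> ws F"
    and F': "F' \<in> faces V E pos \<gamma>" "clockwise_boundary \<gamma> ws' F'" and ne: "F \<noteq> F'"
    and j: "j < length ws" "j' < length ws'"
    and u: "ws ! j = ws' ! j'" "ws ! (Suc j mod length ws) = ws' ! (Suc j' mod length ws')"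
  shows False
proof -
  define u v where "u = ws ! j" and "v = ws ! (Suc j mod length ws)"
  obtain A where A: "{u, v} \<in> E" "path A" "pathstart A = pos v" "pathfinish A = pos u"
    "path_image (\<gamma> u v) \<union> path_image A = drawing \<gamma> (cycle_edges ws)"
    "path_image (\<gamma> u v) \<inter> path_image A \<subseteq> {pos u, pos v}"
    "\<And>z. z \<notin> drawing \<gamma> (cycle_edges ws) \<Longrightarrow>
      winding_number (cycle_path \<gamma> ws) z = winding_number (\<gamma> u v) z + winding_number A z"
    using cycle_split[OF cyc(1) j(1) u_def v_def] by metis
  have u': "u = ws' ! j'" "v = ws' ! (Suc j' mod length ws')" using u by (auto simp: u_def v_def)
  obtain B where B: "path B" "pathstart B = pos v" "pathfinish B = pos u"
    "path_image (\<gamma> u v) \<union> path_image B = drawing \<gamma> (cycle_edges ws')"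
    "path_image (\<gamma> u v) \<inter> path_image B \<subseteq> {pos u, pos v}"
    "\<And>z. z \<notin> drawing \<gamma> (cycle_edges ws') \<Longrightarrow>
      winding_number (cycle_path \<gamma> ws') z = winding_number (\<gamma> u v) z + winding_number B z"
    using cycle_split[OF cyc(2) j(2) u'] by metis
  have sub: "cycle_edges ws \<subseteq> E" "cycle_edges ws' \<subseteq> E" using cyc by (auto simp: is_cycle_def)
  have arc: "arc (\<gamma> u v)" "pathstart (\<gamma> u v) = pos u" "pathfinish (\<gamma> u v) = pos v"
    using edge_arc[OF A(1)] by auto
  \<comment> \<open>This is the difference of the two cycles. The arc of the common edge has
    cancelled, which relies on the assumed equal directions.\<close>
  define L where "L = A +++ reversepath B"
  have L: "path L" "pathfinish L = pathstart L" "path_image L = path_image A \<union> path_image B"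
    using A B by (auto simp: L_def path_image_join)
  have wL: "winding_number L z = winding_number (cycle_path \<gamma> ws) z - winding_number (cycle_path \<gamma> ws') z"
    if z: "z \<notin> drawing \<gamma> (cycle_edges ws)" "z \<notin> drawing \<gamma> (cycle_edges ws')" for z
  proof -
    have "z \<notin> path_image A" "z \<notin> path_image B" using z A B by auto
    then have "winding_number L z = winding_number A z - winding_number B z"
      using A B by (simp add: L_def winding_number_join winding_number_reversepath)
    then show ?thesis using A(7)[OF z(1)] B(6)[OF z(2)] by simp
  qed
  have wF: "winding_number L z = - 1" if "z \<in> F" for z
    using that wL[of z] face_props(3)[OF F(1)] sub F(2) clockwise_face_winding[OF cyc(2) F' F(1) ne]
    unfolding clockwise_boundary_def by (simp add: disjoint_iff)
  have wF': "winding_number L z = 1" if "z \<in> F'" for z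
    using that wL[of z] face_props(3)[OF F'(1)] sub F'(2) clockwise_face_winding[OF cyc(1) F F'(1) ne[symmetric]]
    unfolding clockwise_boundary_def by (simp add: disjoint_iff)
  define q where "q = \<gamma> u v (1/2)"
  have q: "q \<in> path_image (\<gamma> u v)" by (simp add: q_def path_image_def)
  have "inj_on (\<gamma> u v) {0..1}" using arc(1) by (simp add: arc_def)
  then have "q \<noteq> pathstart (\<gamma> u v)" "q \<noteq> pathfinish (\<gamma> u v)"
    unfolding q_def pathstart_def pathfinish_def by (auto dest!: inj_onD[where x = "1/2"])
  then have qL: "q \<notin> path_image L" using q A(6) B(5) L(3) arc by auto
  have "closed (path_image L)" using L(1) by (simp add: closed_path_image)
  then obtain r where r: "r > 0" "ball q r \<subseteq> - path_image L"
    using qL open_contains_ball[of "- path_image L"] by (auto simp: open_Compl)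
  have "q \<in> frontier F" "q \<in> frontier F'"
    using F(2) F'(2) q A(5) B(4) unfolding clockwise_boundary_def by auto
  then have "q \<in> closure F" "q \<in> closure F'" by (auto simp: frontier_def)
  then obtain x y where x: "x \<in> F" "dist x q < r" and y: "y \<in> F'" "dist y q < r"
    using r(1) by (meson closure_approachable)
  have "winding_number L x = winding_number L y"
    by (rule winding_number_eq[OF L(1,2), of x "ball q r" y]) (use x y r(2) in \<open>auto simp: dist_commute\<close>)
  then show False using wF[OF x(1)] wF'[OF y(1)] by simp
qed

end

section \<open>The structure of a polygon ring\<close>

text \<open>With at least three vertices two positions cannot be cyclic successors of each other, so
  equal vertex pairs come from equal positions.\<close>

lemma inj_on_cycle_edge:
  assumes "distinct ws" "3 \<le> length ws"
  shows "inj_on (cycle_edge ws) {..<length ws}"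
proof (rule inj_onI)
  fix i j assume ij: "i \<in> {..<length ws}" "j \<in> {..<length ws}" "cycle_edge ws i = cycle_edge ws j"
  have S: "Suc i mod length ws = (if Suc i = length ws then 0 else Suc i)"
    "Suc j mod length ws = (if Suc j = length ws then 0 else Suc j)"
    using ij by (auto simp: mod_Suc)
  have "Suc i mod length ws < length ws" "Suc j mod length ws < length ws" using ij by (auto intro!: mod_less_divisor)
  then have "i = j \<or> (i = Suc j mod length ws \<and> j = Suc i mod length ws)"
    using ij assms(1) by (auto simp: cycle_edge_def doubleton_eq_iff nth_eq_iff_index_eq)
  then show "i = j" using assms(2) S by (auto split: if_splits)
qed

lemma card_cycle_edges: "distinct ws \<Longrightarrow> 3 \<le> length ws \<Longrightarrow> card (cycle_edges ws) = length ws"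
  unfolding cycle_edges_def using card_image[OF inj_on_cycle_edge] by simp

lemma cycle_edges_subset_set: "g \<in> cycle_edges ws \<Longrightarrow> g \<subseteq> set ws \<and> g \<noteq> {}"
  by (auto simp: cycle_edges_def cycle_edge_def intro!: nth_mem mod_less_divisor)

lemma set_subset_Union_cycle_edges: "set ws \<subseteq> \<Union> (cycle_edges ws)"
  by (fastforce simp: cycle_edges_def cycle_edge_def in_set_conv_nth)

lemma cycle_closed_under_edges:
  assumes "\<And>u v. u \<in> A \<Longrightarrow> {u, v} \<in> cycle_edges ws \<Longrightarrow> v \<in> A" "w \<in> A" "w \<in> set ws"
  shows "set ws \<subseteq> A"
proof -
  obtain j where j: "j < length ws" "ws ! j = w" using assms(3) by (auto simp: in_set_conv_nth)
  have *: "ws ! ((j + d) mod length ws) \<in> A" for d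
  proof (induction d)
    case 0
    then show ?case using j assms(2) by simp
  next
    case (Suc d)
    let ?t = "(j + d) mod length ws"
    have "?t < length ws" using j by (intro mod_less_divisor) auto
    then have "cycle_edge ws ?t \<in> cycle_edges ws" by (simp add: cycle_edges_def)
    then have "{ws ! ?t, ws ! ((j + Suc d) mod length ws)} \<in> cycle_edges ws"
      by (simp add: cycle_edge_def mod_Suc_eq)
    then show ?case using assms(1) Suc by blast
  qed
  show ?thesis
  proof
    fix v assume "v \<in> set ws"
    then obtain i where i: "i < length ws" "ws ! i = v" by (auto simp: in_set_conv_nth)
    have "(j + (i + length ws - j)) mod length ws = i" using i j by simp
    then show "v \<in> A" using *[of "i + length ws - j"] i by simp
  qed
qed

lemma sum_Suc_indicator:
  "finite A \<Longrightarrow> (\<Sum>x\<in>A. 1 + (if x \<in> B then 1 else 0)) = card A + card (A \<inter> B)"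
  by (simp only: sum.distrib sum.inter_restrict[symmetric] card_eq_sum)

definition next_index :: "nat \<Rightarrow> nat \<Rightarrow> nat" where
  "next_index n i = i mod n + 1"

definition prev_index :: "nat \<Rightarrow> nat \<Rightarrow> nat" where
  "prev_index n i = (if i = 1 then n else i - 1)"

lemma next_index_eq: "i \<in> {1..n} \<Longrightarrow> next_index n i = (if i = n then 1 else Suc i)"
  by (auto simp: next_index_def)

lemma next_index_in: "i \<in> {1..n} \<Longrightarrow> next_index n i \<in> {1..n}"
  and prev_index_in: "i \<in> {1..n} \<Longrightarrow> prev_index n i \<in> {1..n}"
  by (auto simp: next_index_eq prev_index_def)

lemma next_prev_index: "i \<in> {1..n} \<Longrightarrow> next_index n (prev_index n i) = i"
  by (cases "i = 1") (auto simp: next_index_def prev_index_def)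

lemma prev_next_index: "i \<in> {1..n} \<Longrightarrow> prev_index n (next_index n i) = i"
  by (cases "i = n") (auto simp: next_index_eq prev_index_def)

text \<open>For \<open>n = 2\<close> the indices 1 and 2 would give the same pair;
  \<open>3 \<le> n\<close> rules this out.\<close>

lemma prev_index_pair_eq:
  assumes "3 \<le> n" "i \<in> {1..n}" "j \<in> {1..n}" "{prev_index n i, i} = {prev_index n j, j}"
  shows "i = j"
  using assms by (auto simp: doubleton_eq_iff prev_index_def split: if_splits)

section \<open>Incidence counts in a polygon ring\<close>

context polygon_ring
begin

abbreviation "nxt \<equiv> next_index n"
abbreviation "prv \<equiv> prev_index n"

definition "polygons_at v = {i \<in> {1..n}. v \<in> set (p i)}"
definition "polygons_on g = {i \<in> {1..n}. g \<in> cycle_edges (p i)}"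
definition "ring_vertices = (\<Union>i\<in>{1..n}. set (p i))"
definition "ring_edges = (\<Union>i\<in>{1..n}. cycle_edges (p i))"

lemma prv_neq: "i \<in> {1..n} \<Longrightarrow> prv i \<noteq> i" and nxt_neq: "i \<in> {1..n} \<Longrightarrow> nxt i \<noteq> i"
  using ring_size by (auto simp: prev_index_def next_index_eq)

lemma polygon_props:
  assumes "i \<in> {1..n}"
  shows "is_cycle E (p i)" "distinct (p i)" "4 \<le> length (p i)" "cycle_edges (p i) \<subseteq> E" "set (p i) \<subseteq> V"
proof -
  show 1: "is_cycle E (p i)" "4 \<le> length (p i)" using polygon[OF assms] by auto
  then show "distinct (p i)" "cycle_edges (p i) \<subseteq> E" by (auto simp: is_cycle_def)
  then have "\<Union> (cycle_edges (p i)) \<subseteq> V" using graph unfolding simple_graph_def by blast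
  then show "set (p i) \<subseteq> V" using set_subset_Union_cycle_edges[of "p i"] by blast
qed

lemma shared_edge_prv: "i \<in> {1..n} \<Longrightarrow> cycle_edges (p (prv i)) \<inter> cycle_edges (p i) = {e i}"
  using shared_edge[OF prev_index_in] next_prev_index unfolding next_index_def by metis

lemma edge_in_E: "i \<in> {1..n} \<Longrightarrow> e i \<in> E"
  using shared_edge_prv[of i] polygon_props(4)[of i] by blast

text \<open>Both polygons along \<open>e i\<close> contain its ends, and the bound of two polygons
  per vertex leaves no room for a third.\<close>

lemma polygons_at_e: assumes "i \<in> {1..n}" "v \<in> e i" shows "polygons_at v = {prv i, i}"
proof -
  have sub: "{prv i, i} \<subseteq> polygons_at v"
    using shared_edge_prv[OF assms(1)] assms prev_index_in[OF assms(1)]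
      cycle_edges_subset_set[of "e i" "p i"] cycle_edges_subset_set[of "e i" "p (prv i)"]
    unfolding polygons_at_def by auto
  have "v \<in> V" using edge_in_E[OF assms(1)] assms(2) graph by (auto simp: simple_graph_def)
  then have "card (polygons_at v) \<le> 2"
    using vertex_in_two_polygons unfolding polygons_at_def by blast
  moreover have "card {prv i, i} = 2" using prv_neq[OF assms(1)] by simp
  moreover have "finite (polygons_at v)" by (simp add: polygons_at_def)
  ultimately show ?thesis using sub by (metis card_seteq)
qed

lemma e_disjoint: "i \<in> {1..n} \<Longrightarrow> j \<in> {1..n} \<Longrightarrow> i \<noteq> j \<Longrightarrow> e i \<inter> e j = {}"
  using polygons_at_e[of i] polygons_at_e[of j] prev_index_pair_eq[OF ring_size, of i j] by (metis disjoint_iff)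

lemma card_e: "i \<in> {1..n} \<Longrightarrow> card (e i) = 2"
  using edge_in_E graph by (auto simp: simple_graph_def)

lemma inj_on_e: "inj_on e {1..n}"
proof (rule inj_onI)
  fix i j assume ij: "i \<in> {1..n}" "j \<in> {1..n}" "e i = e j"
  then have "e i \<inter> e j \<noteq> {}" using card_e[of j] by auto
  then show "i = j" using e_disjoint ij by blast
qed

lemma polygons_on_subset: "v \<in> g \<Longrightarrow> polygons_on g \<subseteq> polygons_at v"
  using cycle_edges_subset_set by (fastforce simp: polygons_on_def polygons_at_def)

lemma card_polygons_on:
  assumes "g \<in> ring_edges"
  shows "card (polygons_on g) = (if g \<in> e ` {1..n} then 2 else 1)"
proof (cases "g \<in> e ` {1..n}")
  case True
  then obtain i where i: "i \<in> {1..n}" "g = e i" by blast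
  then obtain v where "v \<in> g" using card_e[of i] by fastforce
  have "polygons_on g \<subseteq> {prv i, i}" using polygons_on_subset[OF \<open>v \<in> g\<close>] polygons_at_e[of i v] i \<open>v \<in> g\<close> by auto
  moreover have "{prv i, i} \<subseteq> polygons_on g"
    using shared_edge_prv[OF i(1)] i prev_index_in[OF i(1)] by (auto simp: polygons_on_def)
  ultimately have "polygons_on g = {prv i, i}" by blast
  then show ?thesis using True prv_neq[OF i(1)] by simp
next
  case False
  obtain i where i: "i \<in> {1..n}" "g \<in> cycle_edges (p i)" using assms by (auto simp: ring_edges_def)
  have "j = i" if j: "j \<in> {1..n}" "g \<in> cycle_edges (p j)" for j
  proof (rule ccontr)
    assume ne: "j \<noteq> i"
    consider "j = nxt i" | "i = nxt j" | "j \<noteq> nxt i" "i \<noteq> nxt j" by blast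
    then show False
    proof cases
      case 1
      then have "g = e j" using shared_edge[OF i(1)] i j by (auto simp: next_index_def)
      then show ?thesis using False j by blast
    next
      case 2
      then have "g = e i" using shared_edge[OF j(1)] i j by (auto simp: next_index_def)
      then show ?thesis using False i by blast
    next
      case 3
      then have "cycle_edges (p i) \<inter> cycle_edges (p j) = {}"
        using no_other_shared_edge[OF i(1) j(1)] ne unfolding next_index_def by metis
      then show ?thesis using i j by blast
    qed
  qed
  then have "polygons_on g = {i}" using i unfolding polygons_on_def by blast
  then show ?thesis using False by simp
qed

definition "shared_vertices = {v \<in> ring_vertices. card (polygons_at v) = 2}"

lemma ring_subsets: "ring_vertices \<subseteq> V" "ring_edges \<subseteq> E" "\<Union>ring_edges \<subseteq> ring_vertices" "ring_vertices \<noteq> {}"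
proof -
  show "ring_vertices \<subseteq> V" "ring_edges \<subseteq> E"
    unfolding ring_vertices_def ring_edges_def using polygon_props(4,5) by blast+
  show "\<Union>ring_edges \<subseteq> ring_vertices"
    unfolding ring_vertices_def ring_edges_def using cycle_edges_subset_set by fastforce
  have "1 \<in> {1..n}" "p 1 \<noteq> []" using ring_size polygon_props(3)[of 1] by auto
  then show "ring_vertices \<noteq> {}" unfolding ring_vertices_def by fastforce
qed

lemma finite_ring: "finite ring_vertices" "finite ring_edges"
  using ring_subsets finite_V finite_E finite_subset by blast+

lemma Union_e_shared: "(\<Union>i\<in>{1..n}. e i) \<subseteq> shared_vertices" "card (\<Union>i\<in>{1..n}. e i) = 2 * n"
proof -
  show "(\<Union>i\<in>{1..n}. e i) \<subseteq> shared_vertices"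
  proof
    fix v assume "v \<in> (\<Union>i\<in>{1..n}. e i)"
    then obtain i where i: "i \<in> {1..n}" "v \<in> e i" by blast
    have "card (polygons_at v) = 2" using polygons_at_e[OF i] prv_neq[OF i(1)] by simp
    moreover have "v \<in> set (p i)" using polygons_at_e[OF i] by (auto simp: polygons_at_def)
    ultimately show "v \<in> shared_vertices" using i by (auto simp: shared_vertices_def ring_vertices_def)
  qed
  have "card (\<Union>i\<in>{1..n}. e i) = (\<Sum>i\<in>{1..n}. card (e i))"
    using e_disjoint card_e by (intro card_UN_disjoint) (auto intro: card_ge_0_finite)
  then show "card (\<Union>i\<in>{1..n}. e i) = 2 * n" using card_e by simp
qed

text \<open>Both sides equal the sum of the polygon lengths, once by edge incidences, where the
  \<open>e i\<close> count twice, and once by vertex incidences, where shared vertices count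
  twice.\<close>

lemma ring_count: "card ring_edges + n = card ring_vertices + card shared_vertices"
proof -
  have "(\<Sum>i\<in>{1..n}. card {g \<in> ring_edges. g \<in> cycle_edges (p i)}) = (\<Sum>g\<in>ring_edges. card (polygons_on g))"
    unfolding polygons_on_def by (rule sum_multicount_gen) (auto simp: finite_ring)
  moreover have "{g \<in> ring_edges. g \<in> cycle_edges (p i)} = cycle_edges (p i)" if "i \<in> {1..n}" for i
    using that by (auto simp: ring_edges_def)
  moreover have "card (cycle_edges (p i)) = length (p i)" if "i \<in> {1..n}" for i
    using polygon_props[OF that] by (simp add: card_cycle_edges)
  ultimately have 1: "(\<Sum>i\<in>{1..n}. length (p i)) = (\<Sum>g\<in>ring_edges. card (polygons_on g))" by simp
  have eR: "e ` {1..n} \<subseteq> ring_edges"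
  proof
    fix g assume "g \<in> e ` {1..n}"
    then obtain i where i: "i \<in> {1..n}" "g = e i" by blast
    then have "g \<in> cycle_edges (p i)" using shared_edge_prv[OF i(1)] by blast
    then show "g \<in> ring_edges" using i(1) unfolding ring_edges_def by blast
  qed
  have "(\<Sum>g\<in>ring_edges. card (polygons_on g)) = (\<Sum>g\<in>ring_edges. 1 + (if g \<in> e ` {1..n} then 1 else 0))"
    by (rule sum.cong) (auto simp: card_polygons_on)
  also have "\<dots> = card ring_edges + card (ring_edges \<inter> e ` {1..n})"
    using finite_ring by (intro sum_Suc_indicator)
  also have "ring_edges \<inter> e ` {1..n} = e ` {1..n}" using eR by blast
  also have "card (e ` {1..n}) = n" using card_image[OF inj_on_e] by simp
  finally have 2: "(\<Sum>i\<in>{1..n}. length (p i)) = card ring_edges + n" using 1 by simp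
  have "(\<Sum>i\<in>{1..n}. card {v \<in> ring_vertices. v \<in> set (p i)}) = (\<Sum>v\<in>ring_vertices. card (polygons_at v))"
    unfolding polygons_at_def by (rule sum_multicount_gen) (auto simp: finite_ring)
  moreover have "{v \<in> ring_vertices. v \<in> set (p i)} = set (p i)" if "i \<in> {1..n}" for i
    using that by (auto simp: ring_vertices_def)
  moreover have "card (set (p i)) = length (p i)" if "i \<in> {1..n}" for i
    using polygon_props[OF that] by (simp add: distinct_card)
  ultimately have 3: "(\<Sum>i\<in>{1..n}. length (p i)) = (\<Sum>v\<in>ring_vertices. card (polygons_at v))" by simp
  have pa: "card (polygons_at v) = 1 + (if v \<in> shared_vertices then 1 else 0)" if v: "v \<in> ring_vertices" for v
  proof -
    have "card (polygons_at v) \<le> 2"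
      using vertex_in_two_polygons v ring_subsets(1) unfolding polygons_at_def by blast
    moreover have "polygons_at v \<noteq> {}" "finite (polygons_at v)"
      using v by (auto simp: polygons_at_def ring_vertices_def)
    then have "card (polygons_at v) \<noteq> 0" by simp
    ultimately show ?thesis using v unfolding shared_vertices_def by auto
  qed
  have "(\<Sum>v\<in>ring_vertices. card (polygons_at v)) = (\<Sum>v\<in>ring_vertices. 1 + (if v \<in> shared_vertices then 1 else 0))"
    by (rule sum.cong) (auto simp: pa)
  also have "\<dots> = card ring_vertices + card (ring_vertices \<inter> shared_vertices)"
    using finite_ring by (intro sum_Suc_indicator)
  also have "ring_vertices \<inter> shared_vertices = shared_vertices" by (auto simp: shared_vertices_def)
  finally show ?thesis using 2 3 by simp
qed

text \<open>A vertex set that no edge leaves contains every polygon it meets; through an end of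
  \<open>e (nxt i)\<close> it then meets the next polygon, and in the end it contains the whole
  ring.\<close>

lemma ring_crossing_connected: "crossing_connected ring_vertices ring_edges"
  unfolding crossing_connected_def
proof (intro allI impI, rule ccontr)
  fix A assume A: "A \<subseteq> ring_vertices" "A \<noteq> {}" "A \<noteq> ring_vertices"
    and no: "\<not> (\<exists>u v. u \<in> A \<and> v \<in> ring_vertices - A \<and> {u, v} \<in> ring_edges)"
  have closed: "set (p i) \<subseteq> A" if i: "i \<in> {1..n}" "w \<in> A" "w \<in> set (p i)" for i w
  proof (rule cycle_closed_under_edges[OF _ i(2,3)])
    fix u v assume uv: "u \<in> A" "{u, v} \<in> cycle_edges (p i)"
    then have "{u, v} \<in> ring_edges" using i by (auto simp: ring_edges_def)
    moreover from this have "v \<in> ring_vertices" using ring_subsets(3) by auto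
    ultimately show "v \<in> A" using no uv(1) by blast
  qed
  have step: "set (p (nxt i)) \<subseteq> A" if i: "i \<in> {1..n}" "set (p i) \<subseteq> A" for i
  proof -
    have nx: "nxt i \<in> {1..n}" using next_index_in i by blast
    then obtain w where w: "w \<in> e (nxt i)" using card_e[of "nxt i"] by fastforce
    have "w \<in> set (p i)" "w \<in> set (p (nxt i))"
      using polygons_at_e[OF nx w] prev_next_index[OF i(1)] by (auto simp: polygons_at_def)
    then show ?thesis using closed[OF nx] i by blast
  qed
  obtain w where "w \<in> A" using A(2) by blast
  then obtain i0 where i0: "i0 \<in> {1..n}" "w \<in> A" "w \<in> set (p i0)"
    using A(1) by (auto simp: ring_vertices_def)
  \<comment> \<open>Applied twice: from \<open>i0\<close> up to \<open>n\<close>, then, after the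
    step from \<open>n\<close> to 1, from 1 upwards.\<close>
  have up: "set (p (a + d)) \<subseteq> A" if "a \<in> {1..n}" "set (p a) \<subseteq> A" "a + d \<le> n" for a d
    using that(3)
  proof (induction d)
    case (Suc d)
    then show ?case using step[of "a + d"] that(1) by (auto simp: next_index_eq)
  qed (use that in simp)
  have "set (p n) \<subseteq> A" using up[of i0 "n - i0"] closed[OF i0] i0 by auto
  then have "set (p 1) \<subseteq> A" using step[of n] ring_size by (auto simp: next_index_eq)
  then have "set (p i) \<subseteq> A" if "i \<in> {1..n}" for i
    using up[of 1 "i - 1"] that by auto
  then have "ring_vertices \<subseteq> A" unfolding ring_vertices_def by blast
  then show False using A(1,3) by blast
qed

lemma card_faces: "finite (components (- skeleton V E))" "card (components (- skeleton V E)) = n + 2"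
proof -
  obtain F Out Inn where F: "faces V E pos \<gamma> = F ` {1..n} \<union> {Out, Inn}"
    "inj_on F {1..n}" "Out \<notin> F ` {1..n}" "Inn \<notin> F ` {1..n}" "Out \<noteq> Inn"
    using ring_faces by metis
  have eq: "components (- skeleton V E) = insert Out (insert Inn (F ` {1..n}))"
    using F(1) unfolding faces_def skeleton_def by auto
  show "finite (components (- skeleton V E))" by (simp add: eq)
  show "card (components (- skeleton V E)) = n + 2"
    unfolding eq using F card_image[OF F(2)] by simp
qed

text \<open>The upper bound for \<open>card shared_vertices\<close> from Euler's inequality meets
  the lower bound from the ends of the \<open>e i\<close>; a missing edge would lower the upper
  bound by one and contradict this.\<close>

lemma ring_covers: "ring_edges = E" "shared_vertices = (\<Union>i\<in>{1..n}. e i)"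
proof -
  have fin: "finite (components (- skeleton ring_vertices ring_edges))"
    using skeleton_components_mono(1)[OF ring_subsets(1) _ ring_subsets(2)] card_faces by simp
  have le: "card (components (- skeleton ring_vertices ring_edges)) \<le> n + 2"
    using skeleton_components_mono(2)[OF ring_subsets(1) _ ring_subsets(2)] card_faces by simp
  have finS: "finite shared_vertices" using finite_ring by (simp add: shared_vertices_def)
  have ge: "2 * n \<le> card shared_vertices"
    using card_mono[OF finS Union_e_shared(1)] Union_e_shared(2) by simp
  have euler: "card ring_edges + 2 \<le> card (components (- skeleton ring_vertices ring_edges)) + card ring_vertices"
    by (rule euler_lower_bound[OF ring_subsets(1,4,2,3) ring_crossing_connected fin])
  show "ring_edges = E"
  proof (rule ccontr)
    assume "ring_edges \<noteq> E"
    then have "card (components (- skeleton ring_vertices ring_edges)) < n + 2"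
      using card_components_two_connected[OF ring_two_connected ring_subsets(1,2)] card_faces by simp
    then show False using euler ring_count ge by linarith
  qed
  have "card shared_vertices \<le> 2 * n" using euler ring_count le by linarith
  then show "shared_vertices = (\<Union>i\<in>{1..n}. e i)"
    using card_seteq[OF finS Union_e_shared(1)] Union_e_shared(2) by simp
qed

text \<open>A vertex on two polygons is shared, hence an end of some \<open>e l\<close>, and then
  the two polygons are exactly \<open>prv l\<close> and \<open>l\<close>.\<close>

lemma common_vertex:
  assumes "i \<in> {1..n}" "j \<in> {1..n}" "i \<noteq> j" "v \<in> set (p i)" "v \<in> set (p j)"
  shows "(j = nxt i \<and> v \<in> e j) \<or> (i = nxt j \<and> v \<in> e i)"
proof -
  have sub: "{i, j} \<subseteq> polygons_at v" using assms by (auto simp: polygons_at_def)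
  have vV: "v \<in> V" using assms polygon_props(5) by blast
  have "card (polygons_at v) \<le> 2" "finite (polygons_at v)"
    using vertex_in_two_polygons[OF vV] by (auto simp: polygons_at_def)
  moreover have "card {i, j} = 2" using assms(3) by simp
  ultimately have eq: "{i, j} = polygons_at v" using card_seteq[OF _ sub] by simp
  then have "card (polygons_at v) = 2" using \<open>card {i, j} = 2\<close> by simp
  then have "v \<in> shared_vertices" using assms by (auto simp: shared_vertices_def ring_vertices_def)
  then obtain l where l: "l \<in> {1..n}" "v \<in> e l" using ring_covers by auto
  then have "{i, j} = {prv l, l}" using eq polygons_at_e by simp
  then show ?thesis using l next_prev_index[OF l(1)] by (auto simp: doubleton_eq_iff)
qed

lemma shared_edge_opposite:
  assumes i: "i \<in> {1..n}" and j: "j < length (p i)" "j' < length (p (nxt i))"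
    and eq: "cycle_edge (p i) j = cycle_edge (p (nxt i)) j'"
  shows "p i ! j = p (nxt i) ! (Suc j' mod length (p (nxt i)))"
    "p i ! (Suc j mod length (p i)) = p (nxt i) ! j'"
proof -
  obtain F Out Inn where F: "faces V E pos \<gamma> = F ` {1..n} \<union> {Out, Inn}"
    "inj_on F {1..n}" "\<forall>i\<in>{1..n}. clockwise_boundary \<gamma> (p i) (F i)"
    using ring_faces by metis
  have nx: "nxt i \<in> {1..n}" using next_index_in i by blast
  have ne: "F i \<noteq> F (nxt i)" using F(2) i nx nxt_neq[OF i] by (metis inj_onD)
  have "\<not> (p i ! j = p (nxt i) ! j' \<and>
    p i ! (Suc j mod length (p i)) = p (nxt i) ! (Suc j' mod length (p (nxt i))))"
    using clockwise_faces_opposite[OF polygon_props(1)[OF i] polygon_props(1)[OF nx] _ _ _ _ ne j] F i nx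
    by blast
  then show "p i ! j = p (nxt i) ! (Suc j' mod length (p (nxt i)))"
    "p i ! (Suc j mod length (p i)) = p (nxt i) ! j'"
    using eq j by (auto simp: cycle_edge_def doubleton_eq_iff)
qed

end

section \<open>The transfer matrices\<close>

text \<open>Each entry records the element chosen and the state reached. The state of departure is
  the parameter \<open>x\<close>, so \<open>x\<close> and the list together determine the
  walk.\<close>

fun chain_lists :: "('s \<Rightarrow> 's \<Rightarrow> 'w set) list \<Rightarrow> 's \<Rightarrow> 's \<Rightarrow> ('w \<times> 's) list set" where
  "chain_lists [] x y = (if x = y then {[]} else {})"
| "chain_lists (S # Ss) x y = (\<Union>z. \<Union>w\<in>S x z. (#) (w, z) ` chain_lists Ss z y)"

lemma card_chain_lists:
  fixes x y :: "'s::finite"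
  assumes "\<And>S x z. S \<in> set Ss \<Longrightarrow> finite (S x z)"
  shows "finite (chain_lists Ss x y) \<and>
    card (chain_lists Ss x y) = matrix_prod (map (\<lambda>S. (\<chi> x z. card (S x z)) :: nat^'s^'s) Ss) $ x $ y"
  using assms
proof (induction Ss arbitrary: x)
  case Nil
  then show ?case by (simp add: matrix_prod_def mat_def)
next
  case (Cons S Ss)
  have IH: "finite (chain_lists Ss z y)"
    "card (chain_lists Ss z y) = matrix_prod (map (\<lambda>S. (\<chi> x z. card (S x z)) :: nat^'s^'s) Ss) $ z $ y" for z
    using Cons by auto
  have finS: "finite (S x z)" for z using Cons.prems by simp
  let ?D = "SIGMA z:UNIV. S x z \<times> chain_lists Ss z y"
  have eq: "chain_lists (S # Ss) x y = (\<lambda>(z, w, ws). (w, z) # ws) ` ?D"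
  proof
    show "chain_lists (S # Ss) x y \<subseteq> (\<lambda>(z, w, ws). (w, z) # ws) ` ?D"
    proof
      fix vs assume "vs \<in> chain_lists (S # Ss) x y"
      then obtain z w ws where "w \<in> S x z" "ws \<in> chain_lists Ss z y" "vs = (w, z) # ws" by auto
      then show "vs \<in> (\<lambda>(z, w, ws). (w, z) # ws) ` ?D"
        by (intro image_eqI[of _ _ "(z, w, ws)"]) auto
    qed
  qed auto
  have inj: "inj_on (\<lambda>(z, w, ws). (w, z) # ws) ?D" by (auto simp: inj_on_def)
  have finD: "finite ?D" using finS IH(1) by auto
  have "card (chain_lists (S # Ss) x y) = card ?D" unfolding eq by (rule card_image[OF inj])
  also have "\<dots> = (\<Sum>z\<in>UNIV. card (S x z) * card (chain_lists Ss z y))"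
    using finS IH(1) by (simp add: card_cartesian_product)
  also have "\<dots> = matrix_prod (map (\<lambda>S. (\<chi> x z. card (S x z)) :: nat^'s^'s) (S # Ss)) $ x $ y"
    by (simp add: IH(2) matrix_prod_def matrix_matrix_mult_def)
  finally show ?case using finD unfolding eq by simp
qed

text \<open>Passes from lists to families: \<open>N\<close> holds the choices and \<open>s\<close>
  the states, which carry one index more than the choices.\<close>

lemma chain_lists_upt:
  "chain_lists (map S [a..<a + l]) x y =
    {map (\<lambda>i. (N i, s (Suc i))) [a..<a + l] | N s.
      s a = x \<and> s (a + l) = y \<and> (\<forall>i\<in>{a..<a + l}. N i \<in> S i (s i) (s (Suc i)))}"
proof (induction l arbitrary: a x)
  case 0
  then show ?case by auto
next
  case (Suc l)
  have upt: "[a..<a + Suc l] = a # [Suc a..<Suc a + l]" by (simp add: upt_conv_Cons del: upt_Suc)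
  have set: "{a..<a + Suc l} = insert a {Suc a..<Suc a + l}" by auto
  show ?case (is "?L = ?R")
  proof
    show "?L \<subseteq> ?R"
    proof
      fix ws assume "ws \<in> ?L"
      then have "ws \<in> chain_lists (map S (a # [Suc a..<Suc a + l])) x y" by (simp only: upt)
      then obtain z w ws' where ws: "w \<in> S a x z" "ws = (w, z) # ws'" "ws' \<in> chain_lists (map S [Suc a..<Suc a + l]) z y"
        by (auto simp del: upt_Suc)
      then obtain N s where N: "ws' = map (\<lambda>i. (N i, s (Suc i))) [Suc a..<Suc a + l]" "s (Suc a) = z"
        "s (Suc a + l) = y" "\<forall>i\<in>{Suc a..<Suc a + l}. N i \<in> S i (s i) (s (Suc i))"
        unfolding Suc by blast
      let ?N = "N(a := w)" and ?s = "s(a := x)"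
      have "ws = map (\<lambda>i. (?N i, ?s (Suc i))) [a..<a + Suc l]"
        unfolding upt ws(2) N(1) using N(2) by (auto simp del: upt_Suc)
      moreover have "\<forall>i\<in>{a..<a + Suc l}. ?N i \<in> S i (?s i) (?s (Suc i))"
        unfolding set using N ws(1) by auto
      moreover have "?s a = x" "?s (a + Suc l) = y" using N(3) by auto
      ultimately show "ws \<in> ?R" by blast
    qed
    show "?R \<subseteq> ?L"
    proof
      fix ws assume "ws \<in> ?R"
      then obtain N s where N: "ws = map (\<lambda>i. (N i, s (Suc i))) [a..<a + Suc l]" "s a = x" "s (a + Suc l) = y"
        "\<forall>i\<in>{a..<a + Suc l}. N i \<in> S i (s i) (s (Suc i))" by blast
      have "map (\<lambda>i. (N i, s (Suc i))) [Suc a..<Suc a + l] \<in> chain_lists (map S [Suc a..<Suc a + l]) (s (Suc a)) y"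
        unfolding Suc using N(3,4) unfolding set by (intro CollectI exI[of _ N] exI[of _ s] conjI) auto
      moreover have "N a \<in> S a x (s (Suc a))" using N(2,4) by auto
      ultimately show "ws \<in> ?L" unfolding N(1) upt by (auto simp del: upt_Suc)
    qed
  qed
qed

section \<open>The nine states\<close>

lemma exhaust_9:
  fixes x :: 9
  shows "x = 1 \<or> x = 2 \<or> x = 3 \<or> x = 4 \<or> x = 5 \<or> x = 6 \<or> x = 7 \<or> x = 8 \<or> x = 9"
proof (induct x)
  case (of_int z)
  then have "0 \<le> z" and "z < 9" by simp_all
  \<comment> \<open>The representative 0 is the numeral 9.\<close>
  then have "z = 0 \<or> z = 1 \<or> z = 2 \<or> z = 3 \<or> z = 4 \<or> z = 5 \<or> z = 6 \<or> z = 7 \<or> z = 8" by arith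
  then show ?case by auto
qed

text \<open>Reads the column test as the interface to the next polygon, where \<open>d\<close>
  becomes \<open>a\<close> and \<open>c\<close> becomes \<open>b\<close>. \<open>K1\<close>
  uncovered means that \<open>d\<close> is matched along the cycle, so \<open>a\<close> is removed
  next; \<open>e\<close> uncovered means that \<open>a\<close> must be covered next; likewise with
  \<open>K2\<close>, \<open>f\<close> and \<open>b\<close>. The hypotheses leave three statuses per
  end and make the nine conditions mutually exclusive.\<close>

lemma column_index_eq_Some:
  assumes "K1 \<notin> V' \<longrightarrow> Vx k \<in> V'" "K2 \<notin> V' \<longrightarrow> Vx ((k + 3) mod m) \<in> V'"
  shows "column_index m k V' = Some y \<longleftrightarrow>
    (Vx 1 \<in> removed y \<longleftrightarrow> K1 \<notin> V') \<and> (Vx 0 \<in> removed y \<longleftrightarrow> K2 \<notin> V') \<and>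
    (Vx 1 \<in> must_cover y \<longleftrightarrow> Vx k \<notin> V') \<and> (Vx 0 \<in> must_cover y \<longleftrightarrow> Vx ((k + 3) mod m) \<notin> V')"
  using assms exhaust_9[of y]
  by (cases "K1 \<in> V'"; cases "K2 \<in> V'"; cases "Vx k \<in> V'"; cases "Vx ((k + 3) mod m) \<in> V'")
    (auto simp: column_index_def removed_def must_cover_def Let_def)

lemma state_exists:
  assumes "\<not> (ra \<and> ca)" "\<not> (rb \<and> cb)"
  shows "\<exists>y. (Vx 1 \<in> removed y \<longleftrightarrow> ra) \<and> (Vx 0 \<in> removed y \<longleftrightarrow> rb) \<and>
    (Vx 1 \<in> must_cover y \<longleftrightarrow> ca) \<and> (Vx 0 \<in> must_cover y \<longleftrightarrow> cb)"
proof -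
  \<comment> \<open>\<open>column_index\<close> itself serves as the decoder from flags to states.
    With parameters 4 and 0 its vertices \<open>e\<close> and \<open>f\<close> are
    \<open>Vx 0\<close> and \<open>Vx 3\<close>, so a set coding the four flags can be written
    down.\<close>
  define V' where "V' = {v. v = K1 \<and> \<not> ra \<or> v = K2 \<and> \<not> rb \<or> v = Vx 0 \<and> \<not> ca \<or> v = Vx 3 \<and> \<not> cb}"
  have V': "K1 \<in> V' \<longleftrightarrow> \<not> ra" "K2 \<in> V' \<longleftrightarrow> \<not> rb" "Vx 0 \<in> V' \<longleftrightarrow> \<not> ca" "Vx 3 \<in> V' \<longleftrightarrow> \<not> cb"
    by (auto simp: V'_def)
  have "column_index 4 0 V' \<noteq> None"
    using V' assms by (auto simp: column_index_def)
  then obtain y where y: "column_index 4 0 V' = Some y" by blast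
  show ?thesis
    using column_index_eq_Some[of V' 0 4 y] y V' assms by (intro exI[of _ y]) auto
qed

text \<open>Both states are the value of \<open>column_index\<close> on the same coded set.\<close>

lemma state_unique:
  assumes "Vx 1 \<in> removed y \<longleftrightarrow> Vx 1 \<in> removed z" "Vx 0 \<in> removed y \<longleftrightarrow> Vx 0 \<in> removed z"
    "Vx 1 \<in> must_cover y \<longleftrightarrow> Vx 1 \<in> must_cover z" "Vx 0 \<in> must_cover y \<longleftrightarrow> Vx 0 \<in> must_cover z"
  shows "y = z"
proof -
  define V' where "V' = {v. v = K1 \<and> Vx 1 \<notin> removed y \<or> v = K2 \<and> Vx 0 \<notin> removed y \<or>
    v = Vx 0 \<and> Vx 1 \<notin> must_cover y \<or> v = Vx 3 \<and> Vx 0 \<notin> must_cover y}"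
  have V': "K1 \<in> V' \<longleftrightarrow> Vx 1 \<notin> removed y" "K2 \<in> V' \<longleftrightarrow> Vx 0 \<notin> removed y"
    "Vx 0 \<in> V' \<longleftrightarrow> Vx 1 \<notin> must_cover y" "Vx 3 \<in> V' \<longleftrightarrow> Vx 0 \<notin> must_cover y"
    by (auto simp: V'_def)
  have dis: "removed y \<inter> must_cover y = {}"
    using exhaust_9[of y] by (auto simp: removed_def must_cover_def Let_def)
  have pre: "K1 \<notin> V' \<longrightarrow> Vx 0 \<in> V'" "K2 \<notin> V' \<longrightarrow> Vx ((0 + 3) mod 4) \<in> V'"
    using V' dis by auto
  have "column_index 4 0 V' = Some y" using V' by (simp add: column_index_eq_Some[OF pre])
  moreover have "column_index 4 0 V' = Some z" using V' assms by (simp add: column_index_eq_Some[OF pre])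
  ultimately show ?thesis by simp
qed

lemma removed_must_cover:
  "removed x \<subseteq> {Vx 0, Vx 1}" "must_cover x \<subseteq> {Vx 0, Vx 1}" "removed x \<inter> must_cover x = {}"
  using exhaust_9[of x] by (auto simp: removed_def must_cover_def Let_def)

text \<open>Maximality becomes domination: an edge avoiding all covered vertices could be added, and
  conversely a dominated edge outside \<open>M\<close> meets an edge of \<open>M\<close>. An empty
  edge could never be dominated, whence the assumption.\<close>

lemma maximal_matchings_iff:
  assumes "{} \<notin> E"
  shows "M \<in> maximal_matchings E \<longleftrightarrow>
    M \<subseteq> E \<and> (\<forall>g\<in>M. \<forall>h\<in>M. g \<inter> h \<noteq> {} \<longrightarrow> g = h) \<and> (\<forall>g\<in>E. g \<inter> \<Union>M \<noteq> {})"
proof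
  assume M: "M \<in> maximal_matchings E"
  then have mat: "matching E M" and max: "\<And>M'. matching E M' \<Longrightarrow> M \<subset> M' \<Longrightarrow> False"
    by (auto simp: maximal_matchings_def)
  have dom: "g \<inter> \<Union>M \<noteq> {}" if g: "g \<in> E" for g
  proof
    assume "g \<inter> \<Union>M = {}"
    then have dis: "\<And>h. h \<in> M \<Longrightarrow> g \<inter> h = {}" by blast
    have "g \<notin> M" using dis[of g] g assms by auto
    moreover have "matching E (insert g M)"
      using mat g dis unfolding matching_def by (auto simp: Int_commute)
    ultimately show False using max[of "insert g M"] by blast
  qed
  have "M \<subseteq> E" "\<forall>g\<in>M. \<forall>h\<in>M. g \<inter> h \<noteq> {} \<longrightarrow> g = h"
    using mat unfolding matching_def by metis+
  then show "M \<subseteq> E \<and> (\<forall>g\<in>M. \<forall>h\<in>M. g \<inter> h \<noteq> {} \<longrightarrow> g = h) \<and> (\<forall>g\<in>E. g \<inter> \<Union>M \<noteq> {})"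
    using dom by simp
next
  assume M: "M \<subseteq> E \<and> (\<forall>g\<in>M. \<forall>h\<in>M. g \<inter> h \<noteq> {} \<longrightarrow> g = h) \<and> (\<forall>g\<in>E. g \<inter> \<Union>M \<noteq> {})"
  have "False" if M': "matching E M'" "M \<subset> M'" for M'
  proof -
    obtain g where g: "g \<in> M'" "g \<notin> M" using M'(2) by blast
    have "g \<in> E" using g(1) M'(1) by (auto simp: matching_def)
    then have "g \<inter> \<Union>M \<noteq> {}" using M by simp
    then obtain h where h: "h \<in> M" "g \<inter> h \<noteq> {}" by blast
    then have "h \<in> M'" "g \<noteq> h" using M'(2) g(2) by auto
    then show False using M'(1) g(1) h(2) unfolding matching_def by blast
  qed
  moreover have "matching E M" using M unfolding matching_def by metis
  ultimately show "M \<in> maximal_matchings E" unfolding maximal_matchings_def by blast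
qed

text \<open>A set \<open>S\<close> of indices stands for the edges \<open>v\<^sub>j v\<^sub>j\<^sub>+\<^sub>1\<close>, \<open>j \<in> S\<close>, of one polygon.\<close>

definition hit :: "nat \<Rightarrow> nat set \<Rightarrow> nat \<Rightarrow> bool" where
  "hit m S j \<longleftrightarrow> j \<in> S \<or> (\<exists>i\<in>S. Suc i mod m = j)"

text \<open>A removed vertex counts as covered because it is matched inside the preceding
  polygon.\<close>

definition covered :: "nat \<Rightarrow> 9 \<Rightarrow> nat set \<Rightarrow> nat \<Rightarrow> bool" where
  "covered m x S j \<longleftrightarrow> hit m S j \<or> Vx j \<in> removed x"

text \<open>A row matching without its pendant edges. The edge \<open>dc\<close> has index
  \<open>k + 1\<close> and is left to the next polygon; the edges \<open>k\<close> and
  \<open>k + 2\<close> escape the domination test because their ends \<open>d\<close> and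
  \<open>c\<close> are judged there, through the state \<open>y\<close>. The last four conditions
  determine \<open>y\<close> from \<open>x\<close> and \<open>S\<close>.\<close>

definition transition :: "nat \<Rightarrow> nat \<Rightarrow> 9 \<Rightarrow> 9 \<Rightarrow> nat set set" where
  "transition m k x y = {S. S \<subseteq> {..<m} - {k + 1} \<and> (\<forall>j\<in>S. Suc j mod m \<notin> S) \<and>
     (\<forall>j. Vx j \<in> removed x \<longrightarrow> \<not> hit m S j) \<and>
     (\<forall>j<m. j \<notin> {k, k + 1, k + 2} \<longrightarrow> covered m x S j \<or> covered m x S (Suc j mod m)) \<and>
     (\<forall>j. Vx j \<in> must_cover x \<longrightarrow> covered m x S j) \<and>
     (Vx 1 \<in> removed y \<longleftrightarrow> k \<in> S) \<and> (Vx 0 \<in> removed y \<longleftrightarrow> k + 2 \<in> S) \<and>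
     (Vx 1 \<in> must_cover y \<longleftrightarrow> \<not> covered m x S k) \<and>
     (Vx 0 \<in> must_cover y \<longleftrightarrow> \<not> covered m x S ((k + 3) mod m))}"

lemma Suc_mod_eq: "j < m \<Longrightarrow> Suc j mod m = (if Suc j = m then 0 else Suc j)"
  by (auto simp: mod_Suc)

lemma Suc_mod_inj: "i < m \<Longrightarrow> j < m \<Longrightarrow> Suc i mod m = Suc j mod m \<Longrightarrow> i = j"
  by (auto simp: Suc_mod_eq split: if_splits)

section \<open>Maximal matchings of one cut polygon\<close>

locale cut_polygon =
  fixes m k :: nat
  assumes k: "1 \<le> k" "k + 3 \<le> m"
begin

definition "cyc j = {Vx j, Vx (Suc j mod m)}"

text \<open>The pendant edges are determined by \<open>S\<close>: maximality forces \<open>d = v\<^sub>k\<^sub>+\<^sub>1\<close> and \<open>c = v\<^sub>k\<^sub>+\<^sub>2\<close> to be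
  covered.\<close>

definition "lift_set S = cyc ` S \<union> (if k \<in> S then {} else {{K1, Vx (k + 1)}})
  \<union> (if k + 2 \<in> S then {} else {{K2, Vx (k + 2)}})"

lemma cyc_inj: "i < m \<Longrightarrow> j < m \<Longrightarrow> cyc i = cyc j \<Longrightarrow> i = j"
  using k by (auto simp: cyc_def doubleton_eq_iff Suc_mod_eq split: if_splits)

lemma cyc_k: "cyc (k + 1) = {Vx (k + 1), Vx (k + 2)}"
  using k by (simp add: cyc_def)

lemma cut_cycle_eq:
  "cut_cycle m k = cyc ` ({..<m} - {k + 1}) \<union> {{K1, Vx (k + 1)}, {K2, Vx (k + 2)}}"
proof -
  have "{{Vx j, Vx (Suc j mod m)} | j. j < m} = cyc ` {..<m}" by (auto simp: cyc_def)
  moreover have "cyc ` {..<m} - {cyc (k + 1)} = cyc ` ({..<m} - {k + 1})"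
  proof -
    have "inj_on cyc {..<m}" using cyc_inj by (auto intro: inj_onI)
    then show ?thesis using inj_on_image_set_diff[of cyc "{..<m}" "{..<m}" "{k + 1}"] k by simp
  qed
  ultimately show ?thesis unfolding cut_cycle_def by (simp only: cyc_k)
qed

lemma lift_set_vertices:
  assumes "S \<subseteq> {..<m} - {k + 1}"
  shows "K1 \<in> \<Union> (lift_set S) \<longleftrightarrow> k \<notin> S" "K2 \<in> \<Union> (lift_set S) \<longleftrightarrow> k + 2 \<notin> S"
    "Vx j \<in> \<Union> (lift_set S) \<longleftrightarrow> hit m S j \<or> j = k + 1 \<or> j = k + 2"
proof -
  show "K1 \<in> \<Union> (lift_set S) \<longleftrightarrow> k \<notin> S" "K2 \<in> \<Union> (lift_set S) \<longleftrightarrow> k + 2 \<notin> S"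
    by (auto simp: lift_set_def cyc_def)
  have "hit m S (k + 1)" if "k \<in> S" using that k by (auto simp: hit_def intro!: bexI[of _ k])
  moreover have "hit m S (k + 2)" if "k + 2 \<in> S" using that by (auto simp: hit_def)
  moreover have "Vx j \<in> \<Union> (cyc ` S) \<longleftrightarrow> hit m S j" by (auto simp: cyc_def hit_def)
  ultimately show "Vx j \<in> \<Union> (lift_set S) \<longleftrightarrow> hit m S j \<or> j = k + 1 \<or> j = k + 2"
    unfolding lift_set_def by (auto split: if_splits)
qed

lemma lift_set_inj:
  assumes "S \<subseteq> {..<m} - {k + 1}" "S' \<subseteq> {..<m} - {k + 1}" "lift_set S = lift_set S'"
  shows "S = S'"
proof -
  have "cyc j \<in> lift_set S \<longleftrightarrow> j \<in> S" if "S \<subseteq> {..<m} - {k + 1}" "j < m" for S j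
  proof -
    have "cyc j \<noteq> {K1, Vx (k + 1)}" "cyc j \<noteq> {K2, Vx (k + 2)}" by (auto simp: cyc_def)
    then have "cyc j \<in> lift_set S \<longleftrightarrow> cyc j \<in> cyc ` S" unfolding lift_set_def by simp
    also have "\<dots> \<longleftrightarrow> j \<in> S" using that by (auto dest: cyc_inj)
    finally show ?thesis .
  qed
  then have "j \<in> S \<longleftrightarrow> j \<in> S'" if "j < m" for j using assms that by metis
  then show ?thesis using assms(1,2) by blast
qed

text \<open>\<open>?B\<close> expresses that the lift avoids the removed vertices, \<open>?A\<close>
  disjointness and \<open>?C\<close> domination. The lift always covers \<open>d\<close> and
  \<open>c\<close>, by a cycle edge or a pendant one, so every edge at \<open>d\<close> or
  \<open>c\<close> is dominated automatically.\<close>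

lemma lift_set_maximal:
  assumes S: "S \<subseteq> {..<m} - {k + 1}"
  shows "lift_set S \<in> maximal_matchings (remove_vertices (cut_cycle m k) (removed x)) \<longleftrightarrow>
    (\<forall>j\<in>S. Suc j mod m \<notin> S) \<and> (\<forall>j. Vx j \<in> removed x \<longrightarrow> \<not> hit m S j) \<and>
    (\<forall>j<m. j \<notin> {k, k + 1, k + 2} \<longrightarrow> covered m x S j \<or> covered m x S (Suc j mod m))"
    (is "_ \<longleftrightarrow> ?A \<and> ?B \<and> ?C")
proof -
  let ?W = "lift_set S" and ?E = "remove_vertices (cut_cycle m k) (removed x)"
  have sub: "removed x \<subseteq> {Vx 0, Vx 1}" by (rule removed_must_cover)
  \<comment> \<open>\<open>k \<ge> 1\<close> keeps \<open>d\<close> and \<open>c\<close> apart from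
    \<open>a\<close> and \<open>b\<close>.\<close>
  have K: "{K1, Vx (k + 1)} \<inter> removed x = {}" "{K2, Vx (k + 2)} \<inter> removed x = {}"
    using sub k by auto
  have 1: "?W \<subseteq> ?E \<longleftrightarrow> ?B"
  proof -
    have "?W \<subseteq> ?E \<longleftrightarrow> (\<forall>j\<in>S. cyc j \<inter> removed x = {})"
      using S K unfolding remove_vertices_def cut_cycle_eq lift_set_def by auto
    also have "\<dots> \<longleftrightarrow> ?B"
      using sub by (auto simp: cyc_def hit_def disjoint_iff)
    finally show ?thesis .
  qed
  have 2: "(\<forall>g\<in>?W. \<forall>h\<in>?W. g \<inter> h \<noteq> {} \<longrightarrow> g = h) \<longleftrightarrow> ?A" (is "?M \<longleftrightarrow> _")
  proof
    assume M: ?M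
    show ?A
    proof (intro ballI notI)
      fix j assume j: "j \<in> S" "Suc j mod m \<in> S"
      then have "cyc j \<in> ?W" "cyc (Suc j mod m) \<in> ?W" by (auto simp: lift_set_def)
      moreover have "cyc j \<inter> cyc (Suc j mod m) \<noteq> {}" by (auto simp: cyc_def)
      ultimately have "cyc j = cyc (Suc j mod m)" using M by blast
      moreover have "j < m" "Suc j mod m < m" using j S by auto
      ultimately have "j = Suc j mod m" using cyc_inj by blast
      then show False using \<open>j < m\<close> k by (auto simp: Suc_mod_eq split: if_splits)
    qed
  next
    assume A: ?A
    have cc: "i = j" if ij: "i \<in> S" "j \<in> S" "cyc i \<inter> cyc j \<noteq> {}" for i j
    proof -
      have "i < m" "j < m" using ij S by auto
      moreover have "i = j \<or> i = Suc j mod m \<or> j = Suc i mod m \<or> Suc i mod m = Suc j mod m"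
        using ij(3) by (auto simp: cyc_def)
      ultimately show ?thesis using A ij Suc_mod_inj by metis
    qed
    have ck: "j = k" if "j \<in> S" "Vx (k + 1) \<in> cyc j" for j
      using that S by (auto simp: cyc_def Suc_mod_eq split: if_splits)
    have ck2: "j = k + 2" if "j \<in> S" "Vx (k + 2) \<in> cyc j" for j
      using that S by (auto simp: cyc_def Suc_mod_eq split: if_splits)
    have K12: "K1 \<notin> cyc j" "K2 \<notin> cyc j" for j by (auto simp: cyc_def)
    show ?M
    proof (intro ballI impI)
      fix g h assume gh: "g \<in> ?W" "h \<in> ?W" "g \<inter> h \<noteq> {}"
      define a b where "a = {K1, Vx (k + 1)}" and "b = {K2, Vx (k + 2)}"
      have "(\<exists>i\<in>S. g = cyc i) \<or> (k \<notin> S \<and> g = a) \<or> (k + 2 \<notin> S \<and> g = b)"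
        "(\<exists>i\<in>S. h = cyc i) \<or> (k \<notin> S \<and> h = a) \<or> (k + 2 \<notin> S \<and> h = b)"
        using gh(1,2) unfolding lift_set_def a_def b_def by (auto split: if_splits)
      moreover have "cyc i \<inter> a = {}" "a \<inter> cyc i = {}" if "i \<in> S" "k \<notin> S" for i
        using that ck K12 unfolding a_def by auto
      moreover have "cyc i \<inter> b = {}" "b \<inter> cyc i = {}" if "i \<in> S" "k + 2 \<notin> S" for i
        using that ck2 K12 unfolding b_def by auto
      moreover have "a \<inter> b = {}" "b \<inter> a = {}" by (auto simp: a_def b_def)
      ultimately show "g = h" using gh(3) cc by metis
    qed
  qed
  have 3: "(\<forall>g\<in>?E. g \<inter> \<Union>?W \<noteq> {}) \<longleftrightarrow> ?C"
  proof -
    have v: "Vx j \<in> \<Union>?W \<longleftrightarrow> hit m S j \<or> j = k + 1 \<or> j = k + 2" for j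
      by (rule lift_set_vertices(3)[OF S])
    have "(\<forall>g\<in>?E. g \<inter> \<Union>?W \<noteq> {}) \<longleftrightarrow>
      (\<forall>j\<in>{..<m} - {k + 1}. cyc j \<inter> removed x = {} \<longrightarrow> cyc j \<inter> \<Union>?W \<noteq> {})"
    proof -
      have "{K1, Vx (k + 1)} \<inter> \<Union>?W \<noteq> {}" "{K2, Vx (k + 2)} \<inter> \<Union>?W \<noteq> {}"
        using v[of "k + 1"] v[of "k + 2"] by blast+
      then show ?thesis unfolding remove_vertices_def cut_cycle_eq by blast
    qed
    also have "\<dots> \<longleftrightarrow> (\<forall>j\<in>{..<m} - {k + 1}. j \<in> {k, k + 2} \<or> covered m x S j \<or> covered m x S (Suc j mod m))"
    proof (rule ball_cong[OF refl])
      fix j assume j: "j \<in> {..<m} - {k + 1}"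
      show "(cyc j \<inter> removed x = {} \<longrightarrow> cyc j \<inter> \<Union>?W \<noteq> {}) \<longleftrightarrow>
        (j \<in> {k, k + 2} \<or> covered m x S j \<or> covered m x S (Suc j mod m))"
      proof (cases "j \<in> {k, k + 2}")
        case True
        then have "Vx (k + 1) \<in> cyc j \<or> Vx (k + 2) \<in> cyc j" using k by (auto simp: cyc_def)
        then show ?thesis using True v[of "k + 1"] v[of "k + 2"] by blast
      next
        case False
        have "Suc j mod m \<noteq> k + 1" "Suc j mod m \<noteq> k + 2"
          using False j by (auto simp: Suc_mod_eq split: if_splits)
        then have "cyc j \<inter> \<Union>?W \<noteq> {} \<longleftrightarrow> hit m S j \<or> hit m S (Suc j mod m)"
          using v[of j] v[of "Suc j mod m"] False j unfolding cyc_def by auto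
        moreover have "cyc j \<inter> removed x = {} \<longleftrightarrow> Vx j \<notin> removed x \<and> Vx (Suc j mod m) \<notin> removed x"
          by (auto simp: cyc_def)
        ultimately show ?thesis using False unfolding covered_def by blast
      qed
    qed
    also have "\<dots> \<longleftrightarrow> ?C" by auto
    finally show ?thesis .
  qed
  have ne: "{} \<notin> ?E" unfolding remove_vertices_def cut_cycle_eq by (auto simp: cyc_def)
  have "?W \<in> maximal_matchings ?E \<longleftrightarrow> ?B \<and> ?A \<and> ?C"
    unfolding maximal_matchings_iff[OF ne] 1 2 3 by (rule refl)
  then show ?thesis by meson
qed

text \<open>A pendant edge is present exactly when the cycle edge next to it at \<open>d\<close> or
  \<open>c\<close> is absent: the two share a vertex, and if both were missing nothing would
  dominate the pendant edge.\<close>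

lemma maximal_is_lift_set:
  assumes W: "W \<in> maximal_matchings (remove_vertices (cut_cycle m k) (removed x))"
  shows "W = lift_set {j \<in> {..<m} - {k + 1}. cyc j \<in> W}"
proof -
  let ?E = "remove_vertices (cut_cycle m k) (removed x)"
  have sub: "removed x \<subseteq> {Vx 0, Vx 1}" by (rule removed_must_cover)
  have ne: "{} \<notin> ?E" unfolding remove_vertices_def cut_cycle_eq by (auto simp: cyc_def)
  have M: "W \<subseteq> ?E" "\<And>g h. g \<in> W \<Longrightarrow> h \<in> W \<Longrightarrow> g \<inter> h \<noteq> {} \<Longrightarrow> g = h" "\<And>g. g \<in> ?E \<Longrightarrow> g \<inter> \<Union>W \<noteq> {}"
    using W maximal_matchings_iff[OF ne, of W] by auto
  have K: "{K1, Vx (k + 1)} \<in> ?E" "{K2, Vx (k + 2)} \<in> ?E"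
    using sub k unfolding remove_vertices_def cut_cycle_eq by auto
  have WE: "g \<in> cyc ` ({..<m} - {k + 1}) \<or> g = {K1, Vx (k + 1)} \<or> g = {K2, Vx (k + 2)}" if "g \<in> W" for g
    using M(1) that unfolding remove_vertices_def cut_cycle_eq by blast
  have at1: "j = k" if "j < m" "j \<noteq> k + 1" "Vx (k + 1) \<in> cyc j" for j
    using that by (auto simp: cyc_def Suc_mod_eq split: if_splits)
  have at2: "j = k + 2" if "j < m" "j \<noteq> k + 1" "Vx (k + 2) \<in> cyc j" for j
    using that by (auto simp: cyc_def Suc_mod_eq split: if_splits)
  have K12: "K1 \<notin> cyc j" "K2 \<notin> cyc j" for j by (auto simp: cyc_def)
  have in1: "Vx (k + 1) \<in> cyc k" and in2: "Vx (k + 2) \<in> cyc (k + 2)" using k by (auto simp: cyc_def)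
  have k1: "{K1, Vx (k + 1)} \<in> W \<longleftrightarrow> cyc k \<notin> W"
  proof
    assume "{K1, Vx (k + 1)} \<in> W"
    then show "cyc k \<notin> W" using M(2)[of "cyc k" "{K1, Vx (k + 1)}"] in1 K12(1)[of k] by auto
  next
    assume no: "cyc k \<notin> W"
    obtain g where g: "g \<in> W" "{K1, Vx (k + 1)} \<inter> g \<noteq> {}" using M(3)[OF K(1)] by blast
    from WE[OF g(1)] show "{K1, Vx (k + 1)} \<in> W"
      using g no at1 K12 by auto
  qed
  have k2: "{K2, Vx (k + 2)} \<in> W \<longleftrightarrow> cyc (k + 2) \<notin> W"
  proof
    assume "{K2, Vx (k + 2)} \<in> W"
    then show "cyc (k + 2) \<notin> W" using M(2)[of "cyc (k + 2)" "{K2, Vx (k + 2)}"] in2 K12(2)[of "k + 2"] by auto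
  next
    assume no: "cyc (k + 2) \<notin> W"
    obtain g where g: "g \<in> W" "{K2, Vx (k + 2)} \<inter> g \<noteq> {}" using M(3)[OF K(2)] by blast
    from WE[OF g(1)] show "{K2, Vx (k + 2)} \<in> W"
      using g no at2 K12 by auto
  qed
  have km: "k \<in> {..<m} - {k + 1}" "k + 2 \<in> {..<m} - {k + 1}" using k by auto
  show ?thesis
    unfolding lift_set_def using WE k1 k2 km by (auto split: if_splits)
qed

text \<open>\<open>lift_set\<close> is a bijection from the transitions onto the matchings counted
  by the entry.\<close>

lemma transfer_matrix_eq_card: "transfer_matrix m k $ x $ y = card (transition m k x y)"
proof -
  let ?T = "{W \<in> row_matchings m k x. column_index m k (\<Union>W \<union> removed x) = Some y}"
  have key: "lift_set S \<in> ?T \<longleftrightarrow> S \<in> transition m k x y" if S: "S \<subseteq> {..<m} - {k + 1}" for S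
  proof -
    note v = lift_set_vertices[OF S]
    let ?V = "\<Union> (lift_set S) \<union> removed x"
    have K: "K1 \<in> ?V \<longleftrightarrow> k \<notin> S" "K2 \<in> ?V \<longleftrightarrow> k + 2 \<notin> S"
      using v(1,2) removed_must_cover(1)[of x] by auto
    \<comment> \<open>\<open>f\<close> is \<open>Vx (k + 3)\<close> or, at the end of the cycle,
      \<open>Vx 0\<close>; in both cases it is neither \<open>d\<close> nor \<open>c\<close>, the
      two vertices that the lift covers unconditionally.\<close>
    have "(k + 3) mod m \<noteq> k + 1" "(k + 3) mod m \<noteq> k + 2"
      using k by (cases "k + 3 = m"; auto)+
    then have ef: "Vx k \<in> ?V \<longleftrightarrow> covered m x S k" "Vx ((k + 3) mod m) \<in> ?V \<longleftrightarrow> covered m x S ((k + 3) mod m)"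
      using v(3)[of k] v(3)[of "(k + 3) mod m"] by (auto simp: covered_def)
    \<comment> \<open>If \<open>K1\<close> is uncovered, then \<open>d\<close> is matched to
      \<open>e\<close>, so \<open>e\<close> is covered; likewise for \<open>K2\<close> and
      \<open>f\<close>.\<close>
    have "covered m x S k" if "k \<in> S" using that by (simp add: covered_def hit_def)
    moreover have "covered m x S ((k + 3) mod m)" if "k + 2 \<in> S"
      using that by (auto simp: covered_def hit_def eval_nat_numeral)
    ultimately have pre: "K1 \<notin> ?V \<longrightarrow> Vx k \<in> ?V" "K2 \<notin> ?V \<longrightarrow> Vx ((k + 3) mod m) \<in> ?V"
      using K ef by blast+
    have col: "column_index m k ?V = Some y \<longleftrightarrow>
      (Vx 1 \<in> removed y \<longleftrightarrow> k \<in> S) \<and> (Vx 0 \<in> removed y \<longleftrightarrow> k + 2 \<in> S) \<and>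
      (Vx 1 \<in> must_cover y \<longleftrightarrow> \<not> covered m x S k) \<and>
      (Vx 0 \<in> must_cover y \<longleftrightarrow> \<not> covered m x S ((k + 3) mod m))"
      unfolding column_index_eq_Some[OF pre] K ef by simp
    have must: "must_cover x \<subseteq> \<Union> (lift_set S) \<longleftrightarrow> (\<forall>j. Vx j \<in> must_cover x \<longrightarrow> covered m x S j)"
    proof -
      have "Vx j \<in> \<Union> (lift_set S) \<longleftrightarrow> covered m x S j" if j: "Vx j \<in> must_cover x" for j
        using j v(3)[of j] removed_must_cover(2,3)[of x] k by (auto simp: covered_def)
      moreover have "must_cover x \<subseteq> range Vx" using removed_must_cover(2)[of x] by auto
      then have "must_cover x \<subseteq> \<Union> (lift_set S) \<longleftrightarrow> (\<forall>j. Vx j \<in> must_cover x \<longrightarrow> Vx j \<in> \<Union> (lift_set S))"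
        by fast
      ultimately show ?thesis by simp
    qed
    show ?thesis
      using lift_set_maximal[OF S, of x] S unfolding row_matchings_def transition_def mem_Collect_eq col must
      by blast
  qed
  have "?T = lift_set ` transition m k x y"
  proof
    show "?T \<subseteq> lift_set ` transition m k x y"
    proof
      fix W assume W: "W \<in> ?T"
      define S where "S = {j \<in> {..<m} - {k + 1}. cyc j \<in> W}"
      have "W = lift_set S" unfolding S_def
        using W by (intro maximal_is_lift_set[of W x]) (simp add: row_matchings_def)
      moreover have "S \<subseteq> {..<m} - {k + 1}" unfolding S_def by blast
      ultimately have "S \<in> transition m k x y" using key[of S] W by (simp only:)
      then show "W \<in> lift_set ` transition m k x y" using \<open>W = lift_set S\<close> by (rule rev_image_eqI)
    qed
    show "lift_set ` transition m k x y \<subseteq> ?T" using key unfolding transition_def by blast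
  qed
  moreover have "inj_on lift_set (transition m k x y)"
    using lift_set_inj unfolding transition_def by (auto intro!: inj_onI)
  ultimately have "card ?T = card (transition m k x y)" using card_image by metis
  then show ?thesis by (simp add: transfer_matrix_def)
qed

end

section \<open>Maximal matchings of glued polygons\<close>

text \<open>A diagonal entry counts walks returning to their start. By \<open>uniq\<close> the
  choices \<open>N\<close> determine the states, so the trace counts the \<open>N\<close> alone;
  \<open>extensional\<close> provides one function per family on \<open>{1..n}\<close>.\<close>

lemma trace_eq_card_closed_chains:
  fixes S :: "nat \<Rightarrow> 's::finite \<Rightarrow> 's \<Rightarrow> 'w set"
  assumes fin: "\<And>i x z. finite (S i x z)" and n: "1 \<le> n"
    and uniq: "\<And>N s s' i. \<forall>i\<in>{1..n}. N i \<in> S i (s i) (s (next_index n i)) \<Longrightarrow>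
      \<forall>i\<in>{1..n}. N i \<in> S i (s' i) (s' (next_index n i)) \<Longrightarrow> i \<in> {1..n} \<Longrightarrow> s i = s' i"
  shows "trace (matrix_prod (map (\<lambda>i. (\<chi> x z. card (S i x z)) :: nat^'s^'s) [1..<Suc n])) =
    card {N \<in> extensional {1..n}. \<exists>s. \<forall>i\<in>{1..n}. N i \<in> S i (s i) (s (next_index n i))}"
proof -
  let ?L = "map S [1..<Suc n]"
  let ?G = "{N \<in> extensional {1..n}. \<exists>s. \<forall>i\<in>{1..n}. N i \<in> S i (s i) (s (next_index n i))}"
  let ?D = "SIGMA x:UNIV. chain_lists ?L x x"
  have cc: "finite (chain_lists ?L x y) \<and>
    card (chain_lists ?L x y) = matrix_prod (map (\<lambda>S. (\<chi> x z. card (S x z)) :: nat^'s^'s) ?L) $ x $ y" for x y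
    by (rule card_chain_lists) (auto simp: fin)
  have upt: "[1..<Suc n] = [1..<1 + n]" by simp
  have set: "{1..<1 + n} = {1..n}" "set [1..<Suc n] = {1..n}" by auto
  have nth: "ws \<in> chain_lists ?L x y \<longleftrightarrow> (\<exists>N s. ws = map (\<lambda>i. (N i, s (Suc i))) [1..<Suc n] \<and>
      s 1 = x \<and> s (Suc n) = y \<and> (\<forall>i\<in>{1..n}. N i \<in> S i (s i) (s (Suc i))))" for ws x y
    unfolding upt chain_lists_upt set by auto
  define \<sigma> where "\<sigma> N = (SOME s. \<forall>i\<in>{1..n}. N i \<in> S i (s i) (s (next_index n i)))" for N
  have \<sigma>: "\<forall>i\<in>{1..n}. N i \<in> S i (\<sigma> N i) (\<sigma> N (next_index n i))" if "N \<in> ?G" for N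
  proof -
    have "\<exists>s. \<forall>i\<in>{1..n}. N i \<in> S i (s i) (s (next_index n i))" using that by blast
    then show ?thesis unfolding \<sigma>_def by (rule someI_ex)
  qed
  define \<Phi> where "\<Phi> N = (\<sigma> N 1, map (\<lambda>i. (N i, \<sigma> N (next_index n i))) [1..<Suc n])" for N
  have inj: "inj_on \<Phi> ?G"
  proof (rule inj_onI)
    fix N N' assume N: "N \<in> ?G" "N' \<in> ?G" "\<Phi> N = \<Phi> N'"
    then have "N i = N' i" if "i \<in> {1..n}" for i
      using that unfolding \<Phi>_def prod.inject map_eq_conv set by blast
    then show "N = N'" using N by (intro extensionalityI[of N "{1..n}" N']) auto
  qed
  have img: "\<Phi> ` ?G = ?D"
  proof
    show "\<Phi> ` ?G \<subseteq> ?D"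
    proof
      fix d assume "d \<in> \<Phi> ` ?G"
      then obtain N where N: "N \<in> ?G" "d = \<Phi> N" by blast
      \<comment> \<open>Unrolls the cycle: position \<open>Suc n\<close> repeats the state of
        position 1.\<close>
      define s where "s i = (if i = Suc n then \<sigma> N 1 else \<sigma> N i)" for i
      have s: "s i = \<sigma> N i" "s (Suc i) = \<sigma> N (next_index n i)" if "i \<in> {1..n}" for i
        using that unfolding s_def by (auto simp: next_index_eq)
      have "map (\<lambda>i. (N i, \<sigma> N (next_index n i))) [1..<Suc n] = map (\<lambda>i. (N i, s (Suc i))) [1..<Suc n]"
        by (rule map_cong[OF refl]) (simp only: set s(2))
      moreover have "\<forall>i\<in>{1..n}. N i \<in> S i (s i) (s (Suc i))" using \<sigma>[OF N(1)] s by simp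
      moreover have "s 1 = \<sigma> N 1" "s (Suc n) = \<sigma> N 1" using n by (auto simp: s_def)
      ultimately show "d \<in> ?D" unfolding N(2) \<Phi>_def using nth by auto
    qed
    show "?D \<subseteq> \<Phi> ` ?G"
    proof
      fix d assume "d \<in> ?D"
      then obtain x ws where d: "d = (x, ws)" "ws \<in> chain_lists ?L x x" by blast
      then obtain N s where N: "ws = map (\<lambda>i. (N i, s (Suc i))) [1..<Suc n]" "s 1 = x" "s (Suc n) = x"
        "\<forall>i\<in>{1..n}. N i \<in> S i (s i) (s (Suc i))" unfolding nth by blast
      have sn: "s (Suc i) = s (next_index n i)" if "i \<in> {1..n}" for i
        using that N(2,3) by (auto simp: next_index_eq)
      define N' where "N' = restrict N {1..n}"
      have N': "\<forall>i\<in>{1..n}. N' i \<in> S i (s i) (s (next_index n i))"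
        using N(4) sn by (simp add: N'_def)
      then have G: "N' \<in> ?G" by (auto simp: N'_def)
      have s\<sigma>: "\<sigma> N' i = s i" if "i \<in> {1..n}" for i using uniq[OF \<sigma>[OF G] N' that] .
      have "(N' i, \<sigma> N' (next_index n i)) = (N i, s (Suc i))" if "i \<in> {1..n}" for i
        using that s\<sigma>[OF next_index_in[OF that]] sn[OF that] by (simp add: N'_def)
      then have "map (\<lambda>i. (N' i, \<sigma> N' (next_index n i))) [1..<Suc n] = ws" unfolding N(1)
        by (intro map_cong refl) (simp only: set)
      moreover have "\<sigma> N' 1 = x" using s\<sigma>[of 1] N(2) n by simp
      ultimately have "\<Phi> N' = d" by (simp add: \<Phi>_def d)
      then show "d \<in> \<Phi> ` ?G" using G by blast
    qed
  qed
  have "card ?D = card ?G" using card_image[OF inj] by (simp only: img)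
  moreover have "card ?D = (\<Sum>x\<in>UNIV. card (chain_lists ?L x x))" using cc by simp
  moreover have "\<dots> = trace (matrix_prod (map (\<lambda>S. (\<chi> x z. card (S x z)) :: nat^'s^'s) ?L))"
    using cc by (simp add: trace_def)
  ultimately show ?thesis by (simp add: comp_def)
qed

text \<open>The opposite orientations sit in \<open>glue\<close>: \<open>c\<close>, at index
  \<open>k i + 2\<close>, becomes \<open>b\<close>, at index 0, of the successor, and
  \<open>d\<close>, at \<open>k i + 1\<close>, becomes \<open>a\<close>, at 1.
  \<open>separate\<close> excludes all other coincidences between polygons.\<close>

locale glued_polygons =
  fixes n :: nat and m k :: "nat \<Rightarrow> nat" and q :: "nat \<Rightarrow> nat \<Rightarrow> 'v" and E :: "'v set set"
  assumes n: "3 \<le> n"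
    and k: "i \<in> {1..n} \<Longrightarrow> 1 \<le> k i" "i \<in> {1..n} \<Longrightarrow> k i + 3 \<le> m i"
    and q_inj: "i \<in> {1..n} \<Longrightarrow> inj_on (q i) {..<m i}"
    and glue: "i \<in> {1..n} \<Longrightarrow> q (next_index n i) 0 = q i (k i + 2)"
      "i \<in> {1..n} \<Longrightarrow> q (next_index n i) 1 = q i (k i + 1)"
    and separate: "i \<in> {1..n} \<Longrightarrow> i' \<in> {1..n} \<Longrightarrow> i \<noteq> i' \<Longrightarrow> j < m i \<Longrightarrow> j' < m i' \<Longrightarrow> q i j = q i' j' \<Longrightarrow>
      (i' = next_index n i \<and> j' \<in> {0, 1}) \<or> (i = next_index n i' \<and> j \<in> {0, 1})"
    and E_eq: "E = {{q i j, q i (Suc j mod m i)} | i j. i \<in> {1..n} \<and> j < m i}"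
begin

abbreviation "nxt \<equiv> next_index n"
abbreviation "prv \<equiv> prev_index n"

text \<open>The common edge of \<open>i\<close> and its successor, and both its ends, are attributed to the successor:
  \<open>sides i\<close> and \<open>native i\<close> index the edges and vertices that remain with \<open>i\<close>.\<close>

definition "side i j = {q i j, q i (Suc j mod m i)}"
definition "sides i = {..<m i} - {k i + 1}"
definition "native i = {..<m i} - {k i + 1, k i + 2}"

lemma nxt: "i \<in> {1..n} \<Longrightarrow> nxt i \<in> {1..n}" by (rule next_index_in)

lemma m_pos: "i \<in> {1..n} \<Longrightarrow> 4 \<le> m i" using k[of i] by simp

lemma Suc_mod_lt: "i \<in> {1..n} \<Longrightarrow> Suc j mod m i < m i" using m_pos[of i] by simp

lemma q_eq: "i \<in> {1..n} \<Longrightarrow> j < m i \<Longrightarrow> j' < m i \<Longrightarrow> q i j = q i j' \<longleftrightarrow> j = j'"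
  using q_inj[of i] by (auto dest: inj_onD)

lemma nxt_nxt: "i \<in> {1..n} \<Longrightarrow> nxt (nxt i) \<noteq> i"
  using n nxt[of i] by (auto simp: next_index_eq split: if_splits)

lemma nxt_neq: "i \<in> {1..n} \<Longrightarrow> nxt i \<noteq> i"
  using n by (auto simp: next_index_eq)

lemma nxt_inj: "i \<in> {1..n} \<Longrightarrow> i' \<in> {1..n} \<Longrightarrow> nxt i = nxt i' \<Longrightarrow> i = i'"
  by (metis prev_next_index)

text \<open>\<open>separate\<close> fixes the index in the later polygon only; \<open>glue\<close>
  and injectivity then fix the index in the earlier one.\<close>

lemma shared_cases:
  assumes "i \<in> {1..n}" "i' \<in> {1..n}" "i \<noteq> i'" "j < m i" "j' < m i'" "q i j = q i' j'"
  shows "(i' = nxt i \<and> (j' = 0 \<and> j = k i + 2 \<or> j' = 1 \<and> j = k i + 1)) \<or>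
    (i = nxt i' \<and> (j = 0 \<and> j' = k i' + 2 \<or> j = 1 \<and> j' = k i' + 1))"
  using separate[OF assms]
proof (elim disjE conjE)
  assume *: "i' = nxt i" "j' \<in> {0, 1}"
  have "q i (if j' = 0 then k i + 2 else k i + 1) = q i j"
    using * assms(6) glue[OF assms(1)] by auto
  moreover have "(if j' = 0 then k i + 2 else k i + 1) < m i" using k[OF assms(1)] by auto
  ultimately have "j = (if j' = 0 then k i + 2 else k i + 1)"
    using q_eq[OF assms(1,4)] by metis
  then show ?thesis using * by auto
next
  assume *: "i = nxt i'" "j \<in> {0, 1}"
  have "q i' (if j = 0 then k i' + 2 else k i' + 1) = q i' j'"
    using * assms(6) glue[OF assms(2)] by auto
  moreover have "(if j = 0 then k i' + 2 else k i' + 1) < m i'" using k[OF assms(2)] by auto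
  ultimately have "j' = (if j = 0 then k i' + 2 else k i' + 1)"
    using q_eq[OF assms(2,5)] by metis
  then show ?thesis using * by auto
qed

lemma side_vertex:
  assumes "i \<in> {1..n}" "j < m i" "v \<in> side i j"
  obtains a where "a < m i" "v = q i a"
proof -
  have "v = q i j \<or> v = q i (Suc j mod m i)" using assms(3) by (simp add: side_def)
  then show thesis using that assms(2) Suc_mod_lt[OF assms(1)] by blast
qed

text \<open>An edge of \<open>i\<close> with both ends on the successor must be the one with index
  \<open>k i + 1\<close>, which \<open>sides\<close> leaves out.\<close>

lemma side_inj:
  assumes "i \<in> {1..n}" "i' \<in> {1..n}" "j \<in> sides i" "j' \<in> sides i'" "side i j = side i' j'"
  shows "i = i' \<and> j = j'"
proof (cases "i = i'")
  case True
  have "j < m i" "j' < m i" using assms True by (auto simp: sides_def)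
  moreover have "j = j' \<or> (j = Suc j' mod m i \<and> j' = Suc j mod m i)"
    using assms(5) q_eq[OF assms(1)] Suc_mod_lt[OF assms(1)] calculation True
    by (auto simp: side_def doubleton_eq_iff)
  ultimately show ?thesis using True m_pos[OF assms(1)] by (auto simp: Suc_mod_eq split: if_splits)
next
  case False
  have no: False if i: "i \<in> {1..n}" "nxt i \<in> {1..n}" and j: "j \<in> sides i" "j' < m (nxt i)"
    and eq: "side i j = side (nxt i) j'" for i j j'
  proof -
    have "a \<in> {k i + 1, k i + 2}" if a: "a < m i" "q i a \<in> side (nxt i) j'" for a
    proof -
      obtain b where "b < m (nxt i)" "q i a = q (nxt i) b"
        using side_vertex[OF i(2) j(2) a(2)] by blast
      then show ?thesis
        using shared_cases[OF i _ a(1), of b] nxt_neq[OF i(1)] nxt_nxt[OF i(1)] by auto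
    qed
    moreover have "q i j \<in> side (nxt i) j'" "q i (Suc j mod m i) \<in> side (nxt i) j'"
      using eq[symmetric] by (auto simp: side_def)
    ultimately have "j \<in> {k i + 1, k i + 2}" "Suc j mod m i \<in> {k i + 1, k i + 2}"
      using j Suc_mod_lt[OF i(1)] by (auto simp: sides_def)
    then show False using j(1) k[OF i(1)] by (auto simp: sides_def Suc_mod_eq split: if_splits)
  qed
  have "q i j \<in> side i' j'" using assms(5) by (auto simp: side_def)
  moreover have jj: "j < m i" "j' < m i'" using assms by (auto simp: sides_def)
  ultimately obtain b where "b < m i'" "q i j = q i' b"
    using side_vertex[OF assms(2)] by blast
  then have "i' = nxt i \<or> i = nxt i'" using shared_cases[OF assms(1,2) False jj(1)] by blast
  then show ?thesis using no[of i j j'] no[of i' j' j] assms jj by auto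
qed

text \<open>A native vertex has its two cycle edges in the owner; vertices 1 and 0 have in addition
  one edge from the predecessor, with index \<open>k\<close> and \<open>k + 2\<close> there.\<close>

lemma native_in_side:
  assumes i: "i \<in> {1..n}" "i' \<in> {1..n}" and j: "j \<in> native i" "j' \<in> sides i'"
  shows "q i j \<in> side i' j' \<longleftrightarrow> (i' = i \<and> (j' = j \<or> Suc j' mod m i = j)) \<or>
    (i = nxt i' \<and> (j = 1 \<and> j' = k i' \<or> j = 0 \<and> j' = k i' + 2))"
proof (cases "i = i'")
  case True
  have "j < m i" "j' < m i" using j True by (auto simp: native_def sides_def)
  then show ?thesis
    using True q_eq[OF i(1)] Suc_mod_lt[OF i(1)] nxt_neq[OF i(1)] by (auto simp: side_def)
next
  case False
  have jm: "j < m i" "j \<noteq> k i + 1" "j \<noteq> k i + 2" "j' < m i'" "j' \<noteq> k i' + 1"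
    using j by (auto simp: native_def sides_def)
  show ?thesis
  proof
    assume "q i j \<in> side i' j'"
    then obtain b where b: "b = j' \<or> b = Suc j' mod m i'" "q i j = q i' b" by (auto simp: side_def)
    then have "b < m i'" using jm Suc_mod_lt[OF i(2)] by auto
    from shared_cases[OF i False jm(1) this b(2)] jm(2,3)
    have "i = nxt i' \<and> (j = 0 \<and> b = k i' + 2 \<or> j = 1 \<and> b = k i' + 1)" by blast
    then show "(i' = i \<and> (j' = j \<or> Suc j' mod m i = j)) \<or>
      (i = nxt i' \<and> (j = 1 \<and> j' = k i' \<or> j = 0 \<and> j' = k i' + 2))"
      using b(1) jm by (auto simp: Suc_mod_eq split: if_splits)
  next
    assume "(i' = i \<and> (j' = j \<or> Suc j' mod m i = j)) \<or>
      (i = nxt i' \<and> (j = 1 \<and> j' = k i' \<or> j = 0 \<and> j' = k i' + 2))"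
    then show "q i j \<in> side i' j'"
      using False glue[OF i(2)] k[OF i(2)] by (auto simp: side_def)
  qed
qed

lemma native_rep:
  assumes "i \<in> {1..n}" "j < m i"
  obtains i' j' where "i' \<in> {1..n}" "j' \<in> native i'" "q i j = q i' j'"
proof -
  have "0 \<in> native (nxt i)" "1 \<in> native (nxt i)"
    using k[OF nxt[OF assms(1)]] by (auto simp: native_def)
  then show thesis
    using that[of i j] that[of "nxt i" 0] that[of "nxt i" 1] glue[OF assms(1)] nxt[OF assms(1)] assms
    by (cases "j = k i + 1"; cases "j = k i + 2") (auto simp: native_def)
qed

definition "family N = {side i j | i j. i \<in> {1..n} \<and> j \<in> N i}"

lemma E_eq_family: "E = family sides"
proof -
  have "side i j \<in> family sides" if ij: "i \<in> {1..n}" "j < m i" for i j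
  proof (cases "j = k i + 1")
    case True
    have "Suc 0 mod m (nxt i) = 1" using m_pos[OF nxt[OF ij(1)]] by simp
    \<comment> \<open>The edge left out of \<open>sides i\<close> is side 0 of the successor, run
      backwards.\<close>
    then have "side i j = side (nxt i) 0"
      using True glue[OF ij(1)] k[OF ij(1)] by (auto simp: side_def)
    moreover have "0 \<in> sides (nxt i)" using k[OF nxt[OF ij(1)]] by (auto simp: sides_def)
    ultimately show ?thesis using nxt[OF ij(1)] by (auto simp: family_def)
  next
    case False
    then show ?thesis using ij by (auto simp: family_def sides_def)
  qed
  then show ?thesis unfolding E_eq family_def side_def sides_def by blast
qed

text \<open>The interface at the common edge of \<open>i\<close> and its successor: an end of this edge is removed if it
  is matched inside \<open>i\<close>, and must be covered if its neighbour in \<open>i\<close> stays uncovered.\<close>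

definition "states_fit N s \<longleftrightarrow> (\<forall>i\<in>{1..n}.
  (Vx 1 \<in> removed (s (nxt i)) \<longleftrightarrow> k i \<in> N i) \<and> (Vx 0 \<in> removed (s (nxt i)) \<longleftrightarrow> k i + 2 \<in> N i) \<and>
  (Vx 1 \<in> must_cover (s (nxt i)) \<longleftrightarrow> \<not> covered (m i) (s i) (N i) (k i)) \<and>
  (Vx 0 \<in> must_cover (s (nxt i)) \<longleftrightarrow> \<not> covered (m i) (s i) (N i) ((k i + 3) mod m i)))"

lemma states_fitD:
  assumes "states_fit N s" "i \<in> {1..n}"
  shows "Vx 1 \<in> removed (s (nxt i)) \<longleftrightarrow> k i \<in> N i" "Vx 0 \<in> removed (s (nxt i)) \<longleftrightarrow> k i + 2 \<in> N i"
    "Vx 1 \<in> must_cover (s (nxt i)) \<longleftrightarrow> \<not> covered (m i) (s i) (N i) (k i)"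
    "Vx 0 \<in> must_cover (s (nxt i)) \<longleftrightarrow> \<not> covered (m i) (s i) (N i) ((k i + 3) mod m i)"
  using assms unfolding states_fit_def by blast+

section \<open>Matching and domination tested polygon by polygon\<close>

context
  fixes N s
  assumes N: "\<And>i. i \<in> {1..n} \<Longrightarrow> N i \<subseteq> sides i"
    and removed_fit: "\<And>i. i \<in> {1..n} \<Longrightarrow> Vx 1 \<in> removed (s (nxt i)) \<longleftrightarrow> k i \<in> N i"
      "\<And>i. i \<in> {1..n} \<Longrightarrow> Vx 0 \<in> removed (s (nxt i)) \<longleftrightarrow> k i + 2 \<in> N i"
begin

text \<open>The only edges from outside that can cover a native vertex come from the predecessor,
  and \<open>removed_fit\<close> records exactly whether they are chosen.\<close>

lemma native_covered:
  assumes i: "i \<in> {1..n}" "j \<in> native i"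
  shows "q i j \<in> \<Union> (family N) \<longleftrightarrow> covered (m i) (s i) (N i) j"
proof -
  have prv: "prv i \<in> {1..n}" "nxt (prv i) = i" using i prev_index_in next_prev_index by auto
  have "q i j \<in> \<Union> (family N) \<longleftrightarrow> (\<exists>i'\<in>{1..n}. \<exists>j'\<in>N i'. q i j \<in> side i' j')"
    unfolding family_def by blast
  also have "\<dots> \<longleftrightarrow> (\<exists>i'\<in>{1..n}. \<exists>j'\<in>N i'. (i' = i \<and> (j' = j \<or> Suc j' mod m i = j)) \<or>
    (i = nxt i' \<and> (j = 1 \<and> j' = k i' \<or> j = 0 \<and> j' = k i' + 2)))"
    using native_in_side[OF i(1) _ i(2)] N by (intro bex_cong refl) blast
  also have "\<dots> \<longleftrightarrow> hit (m i) (N i) j \<or> (j = 1 \<and> k (prv i) \<in> N (prv i)) \<or> (j = 0 \<and> k (prv i) + 2 \<in> N (prv i))"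
  proof -
    have "i = nxt i' \<longleftrightarrow> i' = prv i" if "i' \<in> {1..n}" for i'
      using that prv prev_next_index by auto
    then have "(\<exists>i'\<in>{1..n}. \<exists>j'\<in>N i'. i = nxt i' \<and> (j = 1 \<and> j' = k i' \<or> j = 0 \<and> j' = k i' + 2)) \<longleftrightarrow>
      (j = 1 \<and> k (prv i) \<in> N (prv i)) \<or> (j = 0 \<and> k (prv i) + 2 \<in> N (prv i))"
      using prv(1) by auto
    moreover have "(\<exists>i'\<in>{1..n}. \<exists>j'\<in>N i'. i' = i \<and> (j' = j \<or> Suc j' mod m i = j)) \<longleftrightarrow> hit (m i) (N i) j"
      using i(1) unfolding hit_def by auto
    ultimately show ?thesis unfolding bex_disj_distrib by simp
  qed
  also have "\<dots> \<longleftrightarrow> hit (m i) (N i) j \<or> (j = 1 \<and> Vx 1 \<in> removed (s i)) \<or> (j = 0 \<and> Vx 0 \<in> removed (s i))"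
    using removed_fit[OF prv(1)] prv(2) by simp
  also have "\<dots> \<longleftrightarrow> covered (m i) (s i) (N i) j"
    unfolding covered_def using removed_must_cover(1)[of "s i"] by auto
  finally show ?thesis .
qed

text \<open>Two intersecting edges are compared at a common vertex, named in its owner. If both
  belong to the owner they coincide or are consecutive; if only one does, the vertex is removed and
  yet hit; if both come from the predecessor they coincide.\<close>

lemma family_matching:
  "(\<forall>g\<in>family N. \<forall>h\<in>family N. g \<inter> h \<noteq> {} \<longrightarrow> g = h) \<longleftrightarrow>
    (\<forall>i\<in>{1..n}. (\<forall>j\<in>N i. Suc j mod m i \<notin> N i) \<and> (\<forall>j. Vx j \<in> removed (s i) \<longrightarrow> \<not> hit (m i) (N i) j))"
  (is "?M \<longleftrightarrow> ?A")
proof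
  assume M: ?M
  have eq: "i = i' \<and> j = j'" if "i \<in> {1..n}" "i' \<in> {1..n}" "j \<in> N i" "j' \<in> N i'" "side i j \<inter> side i' j' \<noteq> {}" for i i' j j'
  proof -
    have "side i j = side i' j'" using M that unfolding family_def by blast
    then show ?thesis using side_inj[of i i' j j'] that N by blast
  qed
  show ?A
  proof (intro ballI conjI allI impI notI)
    fix i j assume i: "i \<in> {1..n}" "j \<in> N i" "Suc j mod m i \<in> N i"
    have "side i j \<inter> side i (Suc j mod m i) \<noteq> {}" by (auto simp: side_def)
    then have "j = Suc j mod m i" using eq[OF i(1,1,2,3)] by blast
    moreover have "j < m i" using i N by (auto simp: sides_def)
    ultimately show False using m_pos[OF i(1)] by (auto simp: Suc_mod_eq split: if_splits)
  next
    fix i j assume i: "i \<in> {1..n}" "Vx j \<in> removed (s i)" "hit (m i) (N i) j"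
    have prv: "prv i \<in> {1..n}" "nxt (prv i) = i" using i prev_index_in next_prev_index by auto
    have "j = 0 \<or> j = 1" using i(2) removed_must_cover(1)[of "s i"] by auto
    then obtain j' where j': "j' \<in> N (prv i)" "q i j \<in> side (prv i) j'"
    proof
      assume "j = 1"
      then have "k (prv i) \<in> N (prv i)" using removed_fit(1)[OF prv(1)] prv(2) i(2) by simp
      moreover have "q i j \<in> side (prv i) (k (prv i))"
        using \<open>j = 1\<close> glue(2)[OF prv(1)] prv(2) k[OF prv(1)] by (auto simp: side_def)
      ultimately show thesis using that by blast
    next
      assume "j = 0"
      then have "k (prv i) + 2 \<in> N (prv i)" using removed_fit(2)[OF prv(1)] prv(2) i(2) by simp
      moreover have "q i j \<in> side (prv i) (k (prv i) + 2)"
        using \<open>j = 0\<close> glue(1)[OF prv(1)] prv(2) by (auto simp: side_def)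
      ultimately show thesis using that by blast
    qed
    moreover obtain l where l: "l \<in> N i" "q i j \<in> side i l" using i(3) by (auto simp: hit_def side_def)
    ultimately have "prv i = i" using eq[OF prv(1) i(1) j'(1) l(1)] by blast
    then show False using prv nxt_neq by metis
  qed
next
  assume A: ?A
  show ?M
  proof (intro ballI impI)
    fix g h assume "g \<in> family N" "h \<in> family N" and gh: "g \<inter> h \<noteq> {}"
    then obtain i1 j1 i2 j2 where g: "i1 \<in> {1..n}" "j1 \<in> N i1" "g = side i1 j1"
      and h: "i2 \<in> {1..n}" "j2 \<in> N i2" "h = side i2 j2" unfolding family_def by blast
    have j: "j1 \<in> sides i1" "j2 \<in> sides i2" using g h N by auto
    obtain v where v: "v \<in> g" "v \<in> h" using gh by blast
    obtain a where "a < m i1" "v = q i1 a"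
      using side_vertex[OF g(1), of j1 v] v(1) g(3) j(1) by (auto simp: sides_def)
    then obtain i0 j0 where i0: "i0 \<in> {1..n}" "j0 \<in> native i0" "v = q i0 j0"
      using native_rep[OF g(1)] by metis
    have no: "\<not> hit (m i0) (N i0) j0"
      if "i' \<in> {1..n}" "j' \<in> N i'" "i0 = nxt i'" "j0 = 1 \<and> j' = k i' \<or> j0 = 0 \<and> j' = k i' + 2" for i' j'
      using that A i0(1) removed_fit[OF that(1)] by auto
    have 1: "(i1 = i0 \<and> (j1 = j0 \<or> Suc j1 mod m i0 = j0)) \<or>
      (i0 = nxt i1 \<and> (j0 = 1 \<and> j1 = k i1 \<or> j0 = 0 \<and> j1 = k i1 + 2))"
      using native_in_side[OF i0(1) g(1) i0(2) j(1)] v(1) g(3) i0(3) by blast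
    have 2: "(i2 = i0 \<and> (j2 = j0 \<or> Suc j2 mod m i0 = j0)) \<or>
      (i0 = nxt i2 \<and> (j0 = 1 \<and> j2 = k i2 \<or> j0 = 0 \<and> j2 = k i2 + 2))"
      using native_in_side[OF i0(1) h(1) i0(2) j(2)] v(2) h(3) i0(3) by blast
    have hit1: "hit (m i0) (N i0) j0" if "i1 = i0" "j1 = j0 \<or> Suc j1 mod m i0 = j0"
      using that g(2) by (auto simp: hit_def)
    have hit2: "hit (m i0) (N i0) j0" if "i2 = i0" "j2 = j0 \<or> Suc j2 mod m i0 = j0"
      using that h(2) by (auto simp: hit_def)
    from 1 show "g = h"
    proof (elim disjE[of "_ \<and> _" "_ \<and> _"])
      assume a: "i1 = i0 \<and> (j1 = j0 \<or> Suc j1 mod m i0 = j0)"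
      then have b: "i2 = i0 \<and> (j2 = j0 \<or> Suc j2 mod m i0 = j0)"
        using 2 hit1 no[OF h(1,2)] by metis
      have "j1 < m i0" "j2 < m i0" using a b j by (auto simp: sides_def)
      moreover have "\<And>j. j \<in> N i0 \<Longrightarrow> Suc j mod m i0 \<notin> N i0" using A i0(1) by blast
      ultimately have "j1 = j2" using a b g(2) h(2) Suc_mod_inj by metis
      then show ?thesis using a b g h by simp
    next
      assume a: "i0 = nxt i1 \<and> (j0 = 1 \<and> j1 = k i1 \<or> j0 = 0 \<and> j1 = k i1 + 2)"
      then have b: "i0 = nxt i2 \<and> (j0 = 1 \<and> j2 = k i2 \<or> j0 = 0 \<and> j2 = k i2 + 2)"
        using 2 hit2 no[OF g(1,2)] by metis
      then have "i1 = i2" using nxt_inj g(1) h(1) a by metis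
      then show ?thesis using a b g h by auto
    qed
  qed
qed

text \<open>Edges with both ends native are tested inside their polygon. The edges
  \<open>k i\<close> and \<open>k i + 2\<close> have one end native to the successor; if the other
  end is uncovered, that end has to be covered, which is the \<open>must_cover\<close> condition
  there.\<close>

lemma family_dominating:
  assumes must_fit: "\<And>i. i \<in> {1..n} \<Longrightarrow> Vx 1 \<in> must_cover (s (nxt i)) \<longleftrightarrow> \<not> covered (m i) (s i) (N i) (k i)"
      "\<And>i. i \<in> {1..n} \<Longrightarrow> Vx 0 \<in> must_cover (s (nxt i)) \<longleftrightarrow> \<not> covered (m i) (s i) (N i) ((k i + 3) mod m i)"
  shows "(\<forall>g\<in>E. g \<inter> \<Union> (family N) \<noteq> {}) \<longleftrightarrow>
    (\<forall>i\<in>{1..n}. (\<forall>j<m i. j \<notin> {k i, k i + 1, k i + 2} \<longrightarrow>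
        covered (m i) (s i) (N i) j \<or> covered (m i) (s i) (N i) (Suc j mod m i)) \<and>
      (\<forall>j. Vx j \<in> must_cover (s i) \<longrightarrow> covered (m i) (s i) (N i) j))"
    (is "?D \<longleftrightarrow> (\<forall>i\<in>{1..n}. ?B i \<and> ?C i)")
proof -
  let ?U = "\<Union> (family N)" and ?c = "\<lambda>i. covered (m i) (s i) (N i)"
  have "?D \<longleftrightarrow> (\<forall>i\<in>{1..n}. \<forall>j\<in>sides i. q i j \<in> ?U \<or> q i (Suc j mod m i) \<in> ?U)"
  proof -
    have "(\<forall>g\<in>family sides. g \<inter> X \<noteq> {}) \<longleftrightarrow> (\<forall>i\<in>{1..n}. \<forall>j\<in>sides i. side i j \<inter> X \<noteq> {})" for X
      unfolding family_def by blast
    moreover have "side i j \<inter> X \<noteq> {} \<longleftrightarrow> q i j \<in> X \<or> q i (Suc j mod m i) \<in> X" for i j X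
      by (auto simp: side_def)
    ultimately show ?thesis unfolding E_eq_family by simp
  qed
  also have "\<dots> \<longleftrightarrow> (\<forall>i\<in>{1..n}. ?B i \<and> (Vx 1 \<in> must_cover (s (nxt i)) \<longrightarrow> ?c (nxt i) 1) \<and>
      (Vx 0 \<in> must_cover (s (nxt i)) \<longrightarrow> ?c (nxt i) 0))"
  proof (rule ball_cong[OF refl])
    fix i assume i: "i \<in> {1..n}"
    have native: "j \<in> native i \<Longrightarrow> q i j \<in> ?U \<longleftrightarrow> ?c i j" for j using native_covered[OF i] by blast
    have nx: "0 \<in> native (nxt i)" "1 \<in> native (nxt i)" using k[OF nxt[OF i]] by (auto simp: native_def)
    have gl: "q i (k i + 1) \<in> ?U \<longleftrightarrow> ?c (nxt i) 1" "q i (k i + 2) \<in> ?U \<longleftrightarrow> ?c (nxt i) 0"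
      using native_covered[OF nxt[OF i] nx(2)] native_covered[OF nxt[OF i] nx(1)] by (simp_all only: glue[OF i])
    have ks: "k i \<in> sides i" "k i + 2 \<in> sides i" "Suc (k i) mod m i = k i + 1"
      "Suc (k i + 2) mod m i = (k i + 3) mod m i" "k i \<in> native i" "(k i + 3) mod m i \<in> native i"
      using k[OF i] by (auto simp: sides_def native_def eval_nat_numeral Suc_mod_eq mod_Suc split: if_splits)
    have "(\<forall>j\<in>sides i. q i j \<in> ?U \<or> q i (Suc j mod m i) \<in> ?U) \<longleftrightarrow>
      (\<forall>j<m i. j \<notin> {k i, k i + 1, k i + 2} \<longrightarrow> q i j \<in> ?U \<or> q i (Suc j mod m i) \<in> ?U) \<and>
      (q i (k i) \<in> ?U \<or> q i (Suc (k i) mod m i) \<in> ?U) \<and>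
      (q i (k i + 2) \<in> ?U \<or> q i (Suc (k i + 2) mod m i) \<in> ?U)"
    proof -
      have "sides i = {j. j < m i \<and> j \<notin> {k i, k i + 1, k i + 2}} \<union> {k i, k i + 2}"
        using ks(1,2) unfolding sides_def by auto
      then have "(\<forall>j\<in>sides i. P j) \<longleftrightarrow> (\<forall>j<m i. j \<notin> {k i, k i + 1, k i + 2} \<longrightarrow> P j) \<and> P (k i) \<and> P (k i + 2)" for P
        by blast
      then show ?thesis .
    qed
    also have "(\<forall>j<m i. j \<notin> {k i, k i + 1, k i + 2} \<longrightarrow> q i j \<in> ?U \<or> q i (Suc j mod m i) \<in> ?U) \<longleftrightarrow> ?B i"
    proof -
      have "j \<in> native i \<and> Suc j mod m i \<in> native i" if "j < m i" "j \<notin> {k i, k i + 1, k i + 2}" for j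
        using that by (auto simp: native_def Suc_mod_eq split: if_splits)
      then show ?thesis using native by auto
    qed
    also have "(q i (k i) \<in> ?U \<or> q i (Suc (k i) mod m i) \<in> ?U) \<longleftrightarrow>
      (Vx 1 \<in> must_cover (s (nxt i)) \<longrightarrow> ?c (nxt i) 1)"
      unfolding ks(3) gl must_fit(1)[OF i] native[OF ks(5)] by blast
    also have "(q i (k i + 2) \<in> ?U \<or> q i (Suc (k i + 2) mod m i) \<in> ?U) \<longleftrightarrow>
      (Vx 0 \<in> must_cover (s (nxt i)) \<longrightarrow> ?c (nxt i) 0)"
      unfolding ks(4) gl must_fit(2)[OF i] native[OF ks(6)] by blast
    finally show "(\<forall>j\<in>sides i. q i j \<in> ?U \<or> q i (Suc j mod m i) \<in> ?U) \<longleftrightarrow>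
      ?B i \<and> (Vx 1 \<in> must_cover (s (nxt i)) \<longrightarrow> ?c (nxt i) 1) \<and>
      (Vx 0 \<in> must_cover (s (nxt i)) \<longrightarrow> ?c (nxt i) 0)" .
  qed
  also have "\<dots> \<longleftrightarrow> (\<forall>i\<in>{1..n}. ?B i \<and> ?C i)"
  proof -
    define P where "P i \<longleftrightarrow> (Vx 1 \<in> must_cover (s i) \<longrightarrow> ?c i 1) \<and> (Vx 0 \<in> must_cover (s i) \<longrightarrow> ?c i 0)" for i
    have C: "?C i \<longleftrightarrow> P i" for i
      unfolding P_def using removed_must_cover(2)[of "s i"] by auto
    \<comment> \<open>\<open>nxt\<close> permutes the indices, so demands on all successors are
      demands on all polygons.\<close>
    have "(\<forall>i\<in>{1..n}. P (nxt i)) \<longleftrightarrow> (\<forall>i\<in>{1..n}. P i)"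
      by (metis nxt prev_index_in next_prev_index)
    then have "(\<forall>i\<in>{1..n}. ?B i \<and> P (nxt i)) \<longleftrightarrow> (\<forall>i\<in>{1..n}. ?B i \<and> P i)"
      by (simp only: ball_conj_distrib)
    then show ?thesis by (simp only: P_def C)
  qed
  finally show ?thesis .
qed

end

lemma family_maximal_iff_transitions:
  assumes N: "\<And>i. i \<in> {1..n} \<Longrightarrow> N i \<subseteq> sides i" and fit: "states_fit N s"
  shows "family N \<in> maximal_matchings E \<longleftrightarrow>
    (\<forall>i\<in>{1..n}. N i \<in> transition (m i) (k i) (s i) (s (nxt i)))"
proof -
  have ne: "{} \<notin> E" by (auto simp: E_eq)
  have sub: "family N \<subseteq> E" unfolding E_eq_family using N by (auto simp: family_def)
  have "family N \<in> maximal_matchings E \<longleftrightarrow> (\<forall>g\<in>family N. \<forall>h\<in>family N. g \<inter> h \<noteq> {} \<longrightarrow> g = h) \<and>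
    (\<forall>g\<in>E. g \<inter> \<Union> (family N) \<noteq> {})"
    by (simp only: maximal_matchings_iff[OF ne] sub simp_thms)
  also have "\<dots> \<longleftrightarrow>
    (\<forall>i\<in>{1..n}. (\<forall>j\<in>N i. Suc j mod m i \<notin> N i) \<and> (\<forall>j. Vx j \<in> removed (s i) \<longrightarrow> \<not> hit (m i) (N i) j)) \<and>
    (\<forall>i\<in>{1..n}. (\<forall>j<m i. j \<notin> {k i, k i + 1, k i + 2} \<longrightarrow>
        covered (m i) (s i) (N i) j \<or> covered (m i) (s i) (N i) (Suc j mod m i)) \<and>
      (\<forall>j. Vx j \<in> must_cover (s i) \<longrightarrow> covered (m i) (s i) (N i) j))"
    by (rule arg_cong2[of _ _ _ _ "(\<and>)", OF family_matching family_dominating])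
      (use N states_fitD[OF fit] in blast)+
  also have "\<dots> \<longleftrightarrow> (\<forall>i\<in>{1..n}. N i \<in> transition (m i) (k i) (s i) (s (nxt i)))"
    unfolding ball_conj_distrib[symmetric]
  proof (rule ball_cong[OF refl])
    fix i assume i: "i \<in> {1..n}"
    show "(((\<forall>j\<in>N i. Suc j mod m i \<notin> N i) \<and> (\<forall>j. Vx j \<in> removed (s i) \<longrightarrow> \<not> hit (m i) (N i) j)) \<and>
        (\<forall>j<m i. j \<notin> {k i, k i + 1, k i + 2} \<longrightarrow>
          covered (m i) (s i) (N i) j \<or> covered (m i) (s i) (N i) (Suc j mod m i)) \<and>
        (\<forall>j. Vx j \<in> must_cover (s i) \<longrightarrow> covered (m i) (s i) (N i) j)) \<longleftrightarrow>
      N i \<in> transition (m i) (k i) (s i) (s (nxt i))"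
      using N[OF i] unfolding transition_def mem_Collect_eq states_fitD[OF fit i] sides_def
      by (simp only: conj_assoc simp_thms)
  qed
  finally show ?thesis .
qed

lemma transitions_fit:
  assumes "\<forall>i\<in>{1..n}. N i \<in> transition (m i) (k i) (s i) (s (nxt i))"
  shows "states_fit N s" "i \<in> {1..n} \<Longrightarrow> N i \<subseteq> sides i"
  using assms unfolding states_fit_def transition_def sides_def by auto

text \<open>Two passes break the circle. \<open>r\<close> prescribes only the \<open>removed\<close>
  flags, which already fixes \<open>covered\<close>; \<open>t\<close> adds the resulting
  \<open>must_cover\<close> flags, and \<open>rt\<close> confirms that \<open>covered\<close> has
  not changed. \<open>t i\<close> is the state handed on by polygon \<open>i\<close>, whence the
  shift by \<open>prv\<close>.\<close>

lemma states_fit_exists: "\<exists>s. states_fit N s"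
proof -
  define R where "R i y \<longleftrightarrow> (Vx 1 \<in> removed y \<longleftrightarrow> k i \<in> N i) \<and> (Vx 0 \<in> removed y \<longleftrightarrow> k i + 2 \<in> N i)" for i y
  have "\<exists>y. R i y" for i unfolding R_def using state_exists[of "k i \<in> N i" False "k i + 2 \<in> N i" False] by blast
  then obtain r where r: "\<And>i. R i (r i)" by metis
  define C where "C i = covered (m i) (r (prv i)) (N i)" for i
  have "\<exists>y. R i y \<and> (Vx 1 \<in> must_cover y \<longleftrightarrow> \<not> C i (k i)) \<and> (Vx 0 \<in> must_cover y \<longleftrightarrow> \<not> C i ((k i + 3) mod m i))" for i
  proof -
    \<comment> \<open>No end is both removed and demanded: the edge of \<open>N i\<close> that
      removes it covers its neighbour in \<open>i\<close>.\<close>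
    have "C i (k i)" if "k i \<in> N i" using that by (simp add: C_def covered_def hit_def)
    moreover have "C i ((k i + 3) mod m i)" if "k i + 2 \<in> N i"
      using that by (auto simp: C_def covered_def hit_def eval_nat_numeral)
    ultimately show ?thesis unfolding R_def
      using state_exists[of "k i \<in> N i" "\<not> C i (k i)" "k i + 2 \<in> N i" "\<not> C i ((k i + 3) mod m i)"] by blast
  qed
  then obtain t where t: "\<And>i. R i (t i) \<and> (Vx 1 \<in> must_cover (t i) \<longleftrightarrow> \<not> C i (k i)) \<and>
    (Vx 0 \<in> must_cover (t i) \<longleftrightarrow> \<not> C i ((k i + 3) mod m i))" by metis
  have rt: "covered (m i) (t (prv i)) (N i) j = C i j" for i j
  proof -
    have "Vx j \<in> removed (t (prv i)) \<longleftrightarrow> Vx j \<in> removed (r (prv i))"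
      using r[of "prv i"] t[of "prv i"] removed_must_cover(1)[of "t (prv i)"] removed_must_cover(1)[of "r (prv i)"]
      unfolding R_def by auto
    then show ?thesis by (simp add: C_def covered_def)
  qed
  have "states_fit N (\<lambda>i. t (prv i))"
    unfolding states_fit_def using t prev_next_index unfolding R_def rt by auto
  then show ?thesis by blast
qed

text \<open>The \<open>removed\<close> flags depend on \<open>N\<close> alone, hence so does
  \<open>covered\<close>, and with it the \<open>must_cover\<close> flags.\<close>

lemma states_fit_unique:
  assumes fit: "states_fit N s" "states_fit N s'" and i: "i \<in> {1..n}"
  shows "s i = s' i"
proof -
  have rem: "Vx 1 \<in> removed (s i) \<longleftrightarrow> Vx 1 \<in> removed (s' i)" "Vx 0 \<in> removed (s i) \<longleftrightarrow> Vx 0 \<in> removed (s' i)"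
    if i: "i \<in> {1..n}" for i
    using states_fitD(1,2)[OF fit(1) prev_index_in[OF i]] states_fitD(1,2)[OF fit(2) prev_index_in[OF i]]
    by (simp_all add: next_prev_index[OF i])
  have prv: "prv i \<in> {1..n}" "nxt (prv i) = i" using i prev_index_in next_prev_index by auto
  have "Vx j \<in> removed (s (prv i)) \<longleftrightarrow> Vx j \<in> removed (s' (prv i))" for j
    using rem[OF prv(1)] removed_must_cover(1)[of "s (prv i)"] removed_must_cover(1)[of "s' (prv i)"] by auto
  then have "covered (m (prv i)) (s (prv i)) (N (prv i)) j = covered (m (prv i)) (s' (prv i)) (N (prv i)) j" for j
    by (simp add: covered_def)
  then show ?thesis
    using states_fitD(3,4)[OF fit(1) prv(1)] states_fitD(3,4)[OF fit(2) prv(1)] rem[OF i]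
    unfolding prv(2) by (intro state_unique) blast+
qed

text \<open>By \<open>side_inj\<close> an edge set splits into polygon parts in one way only; for a
  maximal matching a fitting state family exists and turns maximality into the transition
  conditions.\<close>

lemma Psi_eq_trace:
  "Psi E = trace (matrix_prod (map (\<lambda>i. transfer_matrix (m i) (k i)) [1..<Suc n]))"
proof -
  let ?G = "{N \<in> extensional {1..n}. \<exists>s. \<forall>i\<in>{1..n}. N i \<in> transition (m i) (k i) (s i) (s (nxt i))}"
  have mem: "j \<in> N i \<longleftrightarrow> side i j \<in> family N"
    if "\<And>i. i \<in> {1..n} \<Longrightarrow> N i \<subseteq> sides i" "i \<in> {1..n}" "j \<in> sides i" for N i j
  proof
    assume "side i j \<in> family N"
    then obtain i' j' where ij: "i' \<in> {1..n}" "j' \<in> N i'" "side i j = side i' j'"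
      unfolding family_def by blast
    then have "i = i' \<and> j = j'" using side_inj[of i i' j j'] that by blast
    then show "j \<in> N i" using ij by simp
  qed (use that in \<open>auto simp: family_def\<close>)
  have inj: "inj_on family ?G"
  proof (rule inj_onI)
    fix N N' assume N: "N \<in> ?G" "N' \<in> ?G" "family N = family N'"
    have sub: "N i \<subseteq> sides i" "N' i \<subseteq> sides i" if "i \<in> {1..n}" for i
    proof -
      obtain s where "\<forall>i\<in>{1..n}. N i \<in> transition (m i) (k i) (s i) (s (nxt i))" using N(1) by blast
      then show "N i \<subseteq> sides i" using transitions_fit(2) that by blast
      obtain s' where "\<forall>i\<in>{1..n}. N' i \<in> transition (m i) (k i) (s' i) (s' (nxt i))" using N(2) by blast
      then show "N' i \<subseteq> sides i" using transitions_fit(2) that by blast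
    qed
    have "N i = N' i" if i: "i \<in> {1..n}" for i
    proof -
      have "j \<in> N i \<longleftrightarrow> j \<in> N' i" if "j \<in> sides i" for j
        using mem[OF sub(1) i that] mem[OF sub(2) i that] N(3) by simp
      then show ?thesis using sub[OF i] by blast
    qed
    then show "N = N'" using N by (intro extensionalityI[of N "{1..n}" N']) auto
  qed
  have img: "family ` ?G = maximal_matchings E"
  proof
    show "family ` ?G \<subseteq> maximal_matchings E"
    proof
      fix W assume "W \<in> family ` ?G"
      then obtain N s where W: "W = family N"
        and tr: "\<forall>i\<in>{1..n}. N i \<in> transition (m i) (k i) (s i) (s (nxt i))" by blast
      then show "W \<in> maximal_matchings E"
        using family_maximal_iff_transitions[OF transitions_fit(2)[OF tr] transitions_fit(1)[OF tr]] by simp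
    qed
    show "maximal_matchings E \<subseteq> family ` ?G"
    proof
      fix W assume W: "W \<in> maximal_matchings E"
      then have WE: "W \<subseteq> family sides" by (auto simp: maximal_matchings_def matching_def E_eq_family)
      define N where "N = (\<lambda>i\<in>{1..n}. {j \<in> sides i. side i j \<in> W})"
      have N: "N i \<subseteq> sides i" if "i \<in> {1..n}" for i using that by (auto simp: N_def)
      have fam: "family N = W"
      proof
        show "family N \<subseteq> W" by (auto simp: family_def N_def)
        show "W \<subseteq> family N"
        proof
          fix g assume g: "g \<in> W"
          then obtain i j where ij: "i \<in> {1..n}" "j \<in> sides i" "g = side i j"
            using WE unfolding family_def by blast
          then have "j \<in> N i" using g by (simp add: N_def)
          then show "g \<in> family N" using ij unfolding family_def by blast
        qed
      qed
      obtain s where "states_fit N s" using states_fit_exists by blast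
      then have "\<forall>i\<in>{1..n}. N i \<in> transition (m i) (k i) (s i) (s (nxt i))"
        using family_maximal_iff_transitions[OF N, of s] W fam by simp
      moreover have "N \<in> extensional {1..n}" by (simp add: N_def)
      ultimately have "N \<in> ?G" by blast
      then show "W \<in> family ` ?G" using fam by blast
    qed
  qed
  have "Psi E = card ?G" unfolding Psi_def using card_image[OF inj] by (simp only: img)
  also have "\<dots> = trace (matrix_prod (map (\<lambda>i. (\<chi> x z. card (transition (m i) (k i) x z)) :: nat^9^9) [1..<Suc n]))"
  proof (rule trace_eq_card_closed_chains[symmetric])
    show "finite (transition (m i) (k i) x z)" for i x z
      by (rule finite_subset[of _ "Pow {..<m i}"]) (auto simp: transition_def)
    show "1 \<le> n" using n by simp
    show "s i = s' i"
      if "\<forall>i\<in>{1..n}. N i \<in> transition (m i) (k i) (s i) (s (nxt i))"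
        "\<forall>i\<in>{1..n}. N i \<in> transition (m i) (k i) (s' i) (s' (nxt i))" "i \<in> {1..n}" for N s s' i
      by (rule states_fit_unique[OF transitions_fit(1)[OF that(1)] transitions_fit(1)[OF that(2)] that(3)])
  qed
  also have "map (\<lambda>i. (\<chi> x z. card (transition (m i) (k i) x z)) :: nat^9^9) [1..<Suc n] =
    map (\<lambda>i. transfer_matrix (m i) (k i)) [1..<Suc n]"
  proof (rule map_cong[OF refl])
    fix i assume "i \<in> set [1..<Suc n]"
    then have "cut_polygon (m i) (k i)" using k[of i] by (auto intro!: cut_polygon.intro)
    then show "(\<chi> x z. card (transition (m i) (k i) x z)) = transfer_matrix (m i) (k i)"
      by (simp add: vec_eq_iff cut_polygon.transfer_matrix_eq_card)
  qed
  finally show ?thesis .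
qed

end

theorem theorem2:
  fixes V :: "'v set" and E :: "'v set set"
    and pos :: "'v \<Rightarrow> complex" and \<gamma> :: "'v \<Rightarrow> 'v \<Rightarrow> real \<Rightarrow> complex"
    and n :: nat and p :: "nat \<Rightarrow> 'v list" and e :: "nat \<Rightarrow> 'v set"
    and M :: "nat \<Rightarrow> polygon_type"
  assumes "polygon_ring V E pos \<gamma> n p e"
    and "ring_type n p e M"
  shows "Psi E = trace (matrix_prod (map (\<lambda>i. type_matrix (M i)) [1..<Suc n]))"
proof -
  interpret polygon_ring V E pos \<gamma> n p e by fact
  define m where "m i = length (p i)" for i
  have "\<forall>i\<in>{1..n}. \<exists>k j. k \<in> {1..m i - 3} \<and> M i = Ty (m i) k \<and> j < m i \<and>
    cycle_edge (p i) j = e i \<and> cycle_edge (p i) (j + Suc k) = e (nxt i)"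
    using assms(2) unfolding ring_type_def edges_strictly_between_def m_def next_index_def by blast
  then obtain k J where kJ: "\<And>i. i \<in> {1..n} \<Longrightarrow> k i \<in> {1..m i - 3} \<and> M i = Ty (m i) (k i) \<and> J i < m i \<and>
    cycle_edge (p i) (J i) = e i \<and> cycle_edge (p i) (J i + Suc (k i)) = e (nxt i)"
    by metis
  \<comment> \<open>Renumbers polygon \<open>i\<close> from the position of \<open>e i\<close>: now
    \<open>e i\<close> joins 0 and 1, and \<open>e (nxt i)\<close> joins \<open>k i + 1\<close> and
    \<open>k i + 2\<close>, as in the cycle behind the transfer matrix.\<close>
  define q where "q i j = p i ! ((J i + j) mod m i)" for i j
  have m4: "4 \<le> m i" if "i \<in> {1..n}" for i using polygon_props(3)[OF that] by (simp add: m_def)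
  have qmod: "q i (j mod m i) = q i j" for i j by (simp add: q_def mod_add_right_eq)
  have edge: "cycle_edge (p i) (J i + j) = {q i j, q i (Suc j mod m i)}" for i j
    unfolding qmod by (simp add: cycle_edge_def q_def m_def)
  have qin: "q i j \<in> set (p i)" if "i \<in> {1..n}" for i j
    using m4[OF that] by (auto simp: q_def m_def intro!: nth_mem mod_less_divisor)
  have qinj: "inj_on (q i) {..<m i}" if i: "i \<in> {1..n}" for i
  proof (rule inj_onI)
    fix a b assume ab: "a \<in> {..<m i}" "b \<in> {..<m i}" "q i a = q i b"
    have "(J i + l) mod m i < length (p i)" for l
      using m4[OF i] by (auto simp: m_def intro!: mod_less_divisor)
    then have "(J i + a) mod m i = (J i + b) mod m i"
      using ab(3) nth_eq_iff_index_eq[OF polygon_props(2)[OF i], of "(J i + a) mod m i" "(J i + b) mod m i"]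
      unfolding q_def by blast
    moreover have "(J i + l) mod m i = (if J i + l < m i then J i + l else J i + l - m i)" if "l < m i" for l
    proof -
      have "J i + l - m i < m i" using that kJ[OF i] by linarith
      then show ?thesis by (simp add: mod_if)
    qed
    ultimately show "a = b" using ab(1,2) kJ[OF i] by (auto split: if_splits)
  qed
  have surj: "\<exists>a<m i. j = (J i + a) mod m i" if i: "i \<in> {1..n}" "j < m i" for i j
  proof (intro exI conjI)
    show "(j + m i - J i) mod m i < m i" using m4[OF i(1)] by simp
    show "j = (J i + (j + m i - J i) mod m i) mod m i"
      using kJ[OF i(1)] i(2) by (simp add: mod_add_right_eq)
  qed
  have per: "cycle_edge (p i) (j mod m i) = cycle_edge (p i) j" for i j
    by (simp add: cycle_edge_def m_def mod_Suc_eq)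
  have cyc: "cycle_edges (p i) = {{q i j, q i (Suc j mod m i)} | j. j < m i}" if i: "i \<in> {1..n}" for i
  proof -
    have "cycle_edges (p i) = (\<lambda>j. cycle_edge (p i) (J i + j)) ` {..<m i}"
    proof
      show "cycle_edges (p i) \<subseteq> (\<lambda>j. cycle_edge (p i) (J i + j)) ` {..<m i}"
      proof
        fix g assume "g \<in> cycle_edges (p i)"
        then obtain j where j: "j < m i" "g = cycle_edge (p i) j" by (auto simp: cycle_edges_def m_def)
        obtain a where "a < m i" "j = (J i + a) mod m i" using surj[OF i j(1)] by blast
        then show "g \<in> (\<lambda>j. cycle_edge (p i) (J i + j)) ` {..<m i}" using j(2) per by auto
      qed
      show "(\<lambda>j. cycle_edge (p i) (J i + j)) ` {..<m i} \<subseteq> cycle_edges (p i)"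
      proof
        fix g assume "g \<in> (\<lambda>j. cycle_edge (p i) (J i + j)) ` {..<m i}"
        then obtain j where "g = cycle_edge (p i) ((J i + j) mod m i)" using per by auto
        moreover have "(J i + j) mod m i < m i" using m4[OF i] by simp
        ultimately show "g \<in> cycle_edges (p i)" by (auto simp: cycle_edges_def m_def)
      qed
    qed
    then show ?thesis unfolding edge by auto
  qed
  have k: "1 \<le> k i" "k i + 3 \<le> m i" if "i \<in> {1..n}" for i
    using kJ[OF that] m4[OF that] by auto
  have e01: "e i = {q i 0, q i 1}" if i: "i \<in> {1..n}" for i
    using kJ[OF i] edge[of i 0] m4[OF i] by simp
  have glue: "q (nxt i) 0 = q i (k i + 2)" "q (nxt i) 1 = q i (k i + 1)" if i: "i \<in> {1..n}" for i
  proof -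
    have nx: "nxt i \<in> {1..n}" using next_index_in i by blast
    let ?j = "(J i + Suc (k i)) mod m i"
    have "cycle_edge (p i) ?j = cycle_edge (p (nxt i)) (J (nxt i))"
      using kJ[OF i] kJ[OF nx] per by simp
    moreover have "?j < length (p i)" "J (nxt i) < length (p (nxt i))"
      using m4[OF i] kJ[OF nx] by (auto simp: m_def intro!: mod_less_divisor)
    \<comment> \<open>Opposite directions along the common edge exchange its ends, so
      \<open>k i + 1\<close> meets 1 and \<open>k i + 2\<close> meets 0.\<close>
    ultimately have "p i ! ?j = p (nxt i) ! (Suc (J (nxt i)) mod length (p (nxt i)))"
      "p i ! (Suc ?j mod length (p i)) = p (nxt i) ! J (nxt i)"
      using shared_edge_opposite[OF i] by blast+
    then show "q (nxt i) 0 = q i (k i + 2)" "q (nxt i) 1 = q i (k i + 1)"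
      using kJ[OF nx] by (auto simp: q_def m_def mod_Suc_eq)
  qed
  have glued: "glued_polygons n m k q E"
  proof
    show "3 \<le> n" by (rule ring_size)
    show "1 \<le> k i" "k i + 3 \<le> m i" "inj_on (q i) {..<m i}"
      "q (nxt i) 0 = q i (k i + 2)" "q (nxt i) 1 = q i (k i + 1)" if "i \<in> {1..n}" for i
      using that k qinj glue by blast+
    show "(i' = nxt i \<and> j' \<in> {0, 1}) \<or> (i = nxt i' \<and> j \<in> {0, 1})"
      if h: "i \<in> {1..n}" "i' \<in> {1..n}" "i \<noteq> i'" "j < m i" "j' < m i'" "q i j = q i' j'" for i i' j j'
    proof -
      have small: "a \<in> {0, 1}" if a: "l \<in> {1..n}" "a < m l" "q l a \<in> e l" for l a
      proof -
        have "q l a = q l 0 \<or> q l a = q l 1" using a(3) e01[OF a(1)] by auto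
        then show ?thesis using qinj[OF a(1)] a(2) m4[OF a(1)] by (auto dest: inj_onD)
      qed
      have "(i' = nxt i \<and> q i' j' \<in> e i') \<or> (i = nxt i' \<and> q i j \<in> e i)"
        using common_vertex[OF h(1-3), of "q i j"] qin[OF h(1)] qin[OF h(2), of j'] h(6) by metis
      then show ?thesis using small h by blast
    qed
    show "E = {{q i j, q i (Suc j mod m i)} | i j. i \<in> {1..n} \<and> j < m i}"
    proof -
      have "E = (\<Union>i\<in>{1..n}. {{q i j, q i (Suc j mod m i)} | j. j < m i})"
        using ring_covers(1) cyc unfolding ring_edges_def by simp
      then show ?thesis by blast
    qed
  qed
  have "map (\<lambda>i. transfer_matrix (m i) (k i)) [1..<Suc n] = map (\<lambda>i. type_matrix (M i)) [1..<Suc n]"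
    by (rule map_cong[OF refl]) (use kJ in auto)
  then show ?thesis using glued_polygons.Psi_eq_trace[OF glued] by (simp only:)
qed

end
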